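(* Let $n\geq 2$ be an integer, let $0<p_1,\ldots,p_n<\infty$ satisfy $\frac12\leq\frac1{p_1}+\cdots+\frac1{p_n}<1$, and let $\frac2n\leq q<\infty$. (i) If $q\geq 2$, then $\mathcal{C}_q\circ\mathcal{L}\subseteq\mathcal{C}_q^n$ and $\|T\|_{\mathcal{C}_q^n}\leq\|T\|_{\mathcal{C}_q\circ\mathcal{L}}$ for every $T \in \mathcal{C}_q\circ\mathcal{L}$. (ii) If $0<p<\infty$ and $\frac1p\leq\frac1{p_1}+\cdots+\frac1{p_n}$, then $\tau_p\circ\mathcal{L}\subseteq\tau_{p_1,\ldots,p_n}$ and $\|T\|_{\tau_{p_1,\ldots,p_n}}\leq\|T\|_{\tau_p\circ\mathcal{L}}$ for every $T \in \tau_p\circ\mathcal{L}$. (iii) If $0<q_1,\ldots,q_n<\infty$ and $\frac1q\leq\frac1{q_1}+\cdots+\frac1{q_n}$, then $\mathcal{L}(\mathcal{C}_{q_1},\ldots,\mathcal{C}_{q_n})\subseteq\mathcal{C}_q^n$ and $\|T\|_{\mathcal{C}_q^n}\leq\|T\|_{\mathcal{L}(\mathcal{C}_{q_1},\ldots,\mathcal{C}_{q_n})}$ for every $T\in \mathcal{L}(\mathcal{C}_{q_1},\ldots,\mathcal{C}_{q_n})$.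
   Context: All Banach spaces are over $\mathbb{K}=\mathbb{R}$ or $\mathbb{C}$; $\mathcal{L}(E_1,\ldots,E_n;F)$ is the space of continuous $n$-linear operators from $E_1\times\cdots\times E_n$ to $F$. Let $(r_j)_{j=1}^\infty$ be the Rademacher functions on $[0,1]$. For a finite sequence $(x_j)_{j=1}^k$ in $E$ put $\|(x_j)_{j=1}^k\|_{\mathrm{Rad}(E)} = \left(\int_0^1 \| \sum_{j=1}^k r_j(t)x_j\|^2 dt\right)^{1/2}$ and $\|(x_j)_{j=1}^k\|_{p} = (\sum_{j=1}^k\|x_j\|^p)^{1/p}$. For any $n\ge1$, $T \in \mathcal{L}(E_1,\ldots,E_n;F)$ has type $(p_1,\ldots,p_n)$ if there is $C>0$ such that for all $k\in\mathbb{N}$ and $x_j^{(i)}\in E_i$ ($1\le i\le n$, $1\le j\le k$), $$\|(T(x_j^{(1)},\ldots,x_j^{(n)}))_{j=1}^k\|_{\mathrm{Rad}(F)} \leq C\prod_{i=1}^n \|(x_j^{(i)})_{j=1}^k\|_{p_i};$$ the infimum of such $C$ is $\|T\|_{\tau_{p_1,\ldots,p_n}}$. $T$ has cotype $q$ if there is $M>0$ such that for all such vectors $$\|(T(x_j^{(1)},\ldots,x_j^{(n)}))_{j=1}^k\|_{q} \leq M\prod_{i=1}^n \|(x_j^{(i)})_{j=1}^k\|_{\mathrm{Rad}(E_i)};$$ the infimum of such $M$ is $\|T\|_{\mathcal{C}^n_q}$. The classes of all such operators are $\tau_{p_1,\ldots,p_n}$ and $\mathcal{C}^n_q$. For $n=1$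 these are the classes $\tau_p$, $\mathcal{C}_q$ of linear operators of type $p$ and cotype $q$, with norms $\|\cdot\|_{\tau_p}$, $\|\cdot\|_{\mathcal{C}_q}$. For classes $\mathcal{I},\mathcal{I}_1,\ldots,\mathcal{I}_n$ of linear operators with norms: - $T\in\mathcal{L}(E_1,\ldots,E_n;F)$ belongs to $\mathcal{I}\circ\mathcal{L}$ if there are a Banach space $G$, $u\in\mathcal{I}(G;F)$ and $B\in\mathcal{L}(E_1,\ldots,E_n;G)$ with $T=u\circ B$; $\|T\|_{\mathcal{I}\circ\mathcal{L}}=\inf\|B\|\cdot\|u\|_{\mathcal{I}}$ over all such factorizations. - $T$ belongs to $\mathcal{L}(\mathcal{I}_1,\ldots,\mathcal{I}_n)$ if there are Banach spaces $G_1,\ldots,G_n$, $B\in\mathcal{L}(G_1,\ldots,G_n;F)$ and $u_i\in\mathcal{I}_i(E_i;G_i)$ with $T=B\circ(u_1,\ldots,u_n)$; $\|T\|_{\mathcal{L}(\mathcal{I}_1,\ldots,\mathcal{I}_n)}=\inf\|B\|\cdot\|u_1\|_{\mathcal{I}_1}\cdots\|u_n\|_{\mathcal{I}_n}$ over all such factorizations. *)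

theory Defs
  imports "HOL-Analysis.Analysis" "HOL-Algebra.Module"
begin

section \<open>Banach spaces\<close>

text \<open>
  The scalar field is a type of class \<^class>\<open>real_normed_field\<close>. The types \<^typ>\<open>real\<close> and
  \<^typ>\<open>complex\<close> are instances and, by the Gelfand--Mazur theorem, up to isometric isomorphism
  there are no others, so a type variable of this class ranges over exactly the two admissible
  scalar fields.

  Banach spaces are carrier-based structures, because a statement about an arbitrary number of
  different spaces, with further spaces existentially quantified, cannot be expressed with
  the type class \<^class>\<open>banach\<close>. Each space of a family has its own carrier, operations and norm;
  only the underlying element type is shared. The fields \<open>mult\<close> and \<open>one\<close>
  inherited from the library record are not used.
\<close>

definition scalars :: "'k::real_normed_field ring" where
  "scalars = \<lparr>carrier = UNIV, mult = (*), one = 1, zero = 0, add = (+)\<rparr>"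

record ('k, 'a) normed_module = "('k, 'a) module" +
  vnorm :: "'a \<Rightarrow> real"

text \<open>
  The case distinction is there because the locale \<^locale>\<open>Metric_space\<close> requires nonnegativity and
  symmetry also off the carrier, where the norm is unspecified.
\<close>

definition vdist :: "('k, 'a) normed_module \<Rightarrow> 'a \<Rightarrow> 'a \<Rightarrow> real" where
  "vdist E x y =
    (if x \<in> carrier E \<and> y \<in> carrier E then vnorm E (x \<ominus>\<^bsub>E\<^esub> y) else 0)"

abbreviation vtopology :: "('k, 'a) normed_module \<Rightarrow> 'a topology" where
  "vtopology E \<equiv> Metric_space.mtopology (carrier E) (vdist E)"

locale banach_space = Module.module scalars E
  for E :: "('k::real_normed_field, 'a) normed_module" (structure) +
  assumes vnorm_eq_zero: "\<lbrakk>x \<in> carrier E; vnorm E x = 0\<rbrakk> \<Longrightarrow> x = \<zero>"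
    and vnorm_smult: "x \<in> carrier E \<Longrightarrow> vnorm E (a \<odot> x) = norm a * vnorm E x"
    and vnorm_triangle:
      "\<lbrakk>x \<in> carrier E; y \<in> carrier E\<rbrakk> \<Longrightarrow> vnorm E (x \<oplus> y) \<le> vnorm E x + vnorm E y"
    and complete: "Metric_space.mcomplete (carrier E) (vdist E)"
begin

lemma vnorm_zero: "vnorm E \<zero> = 0"
proof -
  have "(0::'k) \<odot> \<zero> = \<zero>"
    using smult_r_null[of 0] by (simp add: scalars_def)
  then show ?thesis
    using vnorm_smult[of \<zero> "0::'k"] by simp
qed

lemma vnorm_minus: "x \<in> carrier E \<Longrightarrow> vnorm E (\<ominus> x) = vnorm E x"
proof -
  assume x: "x \<in> carrier E"
  have "(-1::'k) \<odot> x \<oplus> x = ((-1) + 1::'k) \<odot> x"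
    using smult_l_distr[of "-1" 1 x] smult_one[OF x] x by (simp add: scalars_def)
  also have "\<dots> = \<zero>"
    using smult_l_null[OF x] by (simp add: scalars_def)
  finally have "\<ominus> x = (-1::'k) \<odot> x"
    using x smult_closed[of "-1" x] minus_equality by (simp add: scalars_def)
  then show ?thesis
    using vnorm_smult[OF x, of "-1"] by simp
qed

lemma vnorm_nonneg: "x \<in> carrier E \<Longrightarrow> 0 \<le> vnorm E x"
proof -
  assume x: "x \<in> carrier E"
  have "vnorm E (x \<oplus> \<ominus> x) \<le> vnorm E x + vnorm E (\<ominus> x)"
    using vnorm_triangle[OF x, of "\<ominus> x"] x by simp
  then show ?thesis
    using x by (simp add: vnorm_minus vnorm_zero M.r_neg)
qed

lemma Metric_space_vdist: "Metric_space (carrier E) (vdist E)"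
proof
  show "0 \<le> vdist E x y" for x y
    by (simp add: vdist_def vnorm_nonneg)
  show "vdist E x y = vdist E y x" for x y
  proof (cases "x \<in> carrier E \<and> y \<in> carrier E")
    case True
    then have "y \<ominus> x = \<ominus> (x \<ominus> y)"
      by (simp add: M.minus_eq M.minus_add M.a_comm)
    then show ?thesis
      using True by (simp add: vdist_def vnorm_minus)
  qed (auto simp: vdist_def)
  show "vdist E x y = 0 \<longleftrightarrow> x = y" if xy: "x \<in> carrier E" "y \<in> carrier E" for x y
  proof
    assume "vdist E x y = 0"
    then have "x \<oplus> \<ominus> y = \<zero>"
      using xy vnorm_eq_zero[of "x \<ominus> y"] by (simp add: vdist_def M.minus_eq)
    then have "\<ominus> (\<ominus> y) = x"
      using xy by (intro M.minus_equality) auto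
    then show "x = y"
      using xy by simp
  next
    assume "x = y"
    then show "vdist E x y = 0"
      using xy by (simp add: vdist_def vnorm_zero M.minus_eq M.r_neg)
  qed
  show "vdist E x z \<le> vdist E x y + vdist E y z"
    if "x \<in> carrier E" "y \<in> carrier E" "z \<in> carrier E" for x y z
  proof -
    have "\<ominus> y \<oplus> (y \<oplus> \<ominus> z) = \<ominus> z"
      using that by (simp add: M.r_neg1)
    then have "x \<ominus> z = (x \<ominus> y) \<oplus> (y \<ominus> z)"
      using that by (simp add: M.minus_eq M.a_assoc)
    then show ?thesis
      using that vnorm_triangle[of "x \<ominus> y" "y \<ominus> z"] by (simp add: vdist_def)
  qed
qed

end


section \<open>Continuous multilinear operators\<close>

text \<open>
  An \<open>n\<close>-tuple is an extensional function on \<open>{1..n}\<close>. An operator is represented by a function of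
  which only the values on the product of the carriers matter; accordingly equality of operators
  always means equality on that product.
\<close>

abbreviation tuples :: "nat \<Rightarrow> (nat \<Rightarrow> ('k, 'e) normed_module) \<Rightarrow> (nat \<Rightarrow> 'e) set" where
  "tuples n E \<equiv> (\<Pi>\<^sub>E i\<in>{1..n}. carrier (E i))"

definition multilinear_ops ::
  "nat \<Rightarrow> (nat \<Rightarrow> ('k::real_normed_field, 'e) normed_module) \<Rightarrow> ('k, 'f) normed_module
    \<Rightarrow> ((nat \<Rightarrow> 'e) \<Rightarrow> 'f) set" where
  "multilinear_ops n E F = {T.
     (\<forall>x\<in>tuples n E. T x \<in> carrier F) \<and>
     (\<forall>x\<in>tuples n E. \<forall>i\<in>{1..n}. \<forall>y\<in>carrier (E i). \<forall>z\<in>carrier (E i).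
        T (x(i := y \<oplus>\<^bsub>E i\<^esub> z)) = T (x(i := y)) \<oplus>\<^bsub>F\<^esub> T (x(i := z))) \<and>
     (\<forall>x\<in>tuples n E. \<forall>i\<in>{1..n}. \<forall>y\<in>carrier (E i). \<forall>a.
        T (x(i := a \<odot>\<^bsub>E i\<^esub> y)) = a \<odot>\<^bsub>F\<^esub> T (x(i := y))) \<and>
     continuous_map (product_topology (\<lambda>i. vtopology (E i)) {1..n}) (vtopology F) T}"

definition op_norm ::
  "nat \<Rightarrow> (nat \<Rightarrow> ('k, 'e) normed_module) \<Rightarrow> ('k, 'f) normed_module
    \<Rightarrow> ((nat \<Rightarrow> 'e) \<Rightarrow> 'f) \<Rightarrow> real" where
  "op_norm n E F T =
    (SUP x\<in>{x \<in> tuples n E. \<forall>i\<in>{1..n}. vnorm (E i) (x i) \<le> 1}. vnorm F (T x))"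


section \<open>Type and cotype\<close>

definition rademacher :: "nat \<Rightarrow> real \<Rightarrow> real" where
  "rademacher j t = sgn (sin (2 ^ j * pi * t))"

definition rad_norm ::
  "('k::real_normed_field, 'a) normed_module \<Rightarrow> nat \<Rightarrow> (nat \<Rightarrow> 'a) \<Rightarrow> real" where
  "rad_norm E k y =
    sqrt (LINT t:{0..1}|lborel.
      (vnorm E (\<Oplus>\<^bsub>E\<^esub>j\<in>{1..k}. of_real (rademacher j t) \<odot>\<^bsub>E\<^esub> y j))\<^sup>2)"

definition lp_norm :: "real \<Rightarrow> ('k, 'a) normed_module \<Rightarrow> nat \<Rightarrow> (nat \<Rightarrow> 'a) \<Rightarrow> real" where
  "lp_norm p E k y = (\<Sum>j=1..k. vnorm E (y j) powr p) powr (1 / p)"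

text \<open>In the next two definitions \<open>x i j\<close> is the \<open>j\<close>-th vector chosen in the space \<open>E i\<close>.\<close>

definition type_const ::
  "nat \<Rightarrow> (nat \<Rightarrow> real) \<Rightarrow> (nat \<Rightarrow> ('k::real_normed_field, 'e) normed_module)
    \<Rightarrow> ('k, 'f) normed_module \<Rightarrow> ((nat \<Rightarrow> 'e) \<Rightarrow> 'f) \<Rightarrow> real \<Rightarrow> bool" where
  "type_const n p E F T C \<longleftrightarrow> C > 0 \<and>
    (\<forall>k x. (\<forall>i\<in>{1..n}. \<forall>j\<in>{1..k}. x i j \<in> carrier (E i)) \<longrightarrow>
       rad_norm F k (\<lambda>j. T (\<lambda>i\<in>{1..n}. x i j)) \<le> C * (\<Prod>i=1..n. lp_norm (p i) (E i) k (x i)))"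

definition cotype_const ::
  "nat \<Rightarrow> real \<Rightarrow> (nat \<Rightarrow> ('k::real_normed_field, 'e) normed_module)
    \<Rightarrow> ('k, 'f) normed_module \<Rightarrow> ((nat \<Rightarrow> 'e) \<Rightarrow> 'f) \<Rightarrow> real \<Rightarrow> bool" where
  "cotype_const n q E F T C \<longleftrightarrow> C > 0 \<and>
    (\<forall>k x. (\<forall>i\<in>{1..n}. \<forall>j\<in>{1..k}. x i j \<in> carrier (E i)) \<longrightarrow>
       lp_norm q F k (\<lambda>j. T (\<lambda>i\<in>{1..n}. x i j)) \<le> C * (\<Prod>i=1..n. rad_norm (E i) k (x i)))"

definition type_ops ::
  "nat \<Rightarrow> (nat \<Rightarrow> real) \<Rightarrow> (nat \<Rightarrow> ('k::real_normed_field, 'e) normed_module)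
    \<Rightarrow> ('k, 'f) normed_module \<Rightarrow> ((nat \<Rightarrow> 'e) \<Rightarrow> 'f) set" where
  "type_ops n p E F = {T \<in> multilinear_ops n E F. \<exists>C. type_const n p E F T C}"

definition type_norm ::
  "nat \<Rightarrow> (nat \<Rightarrow> real) \<Rightarrow> (nat \<Rightarrow> ('k::real_normed_field, 'e) normed_module)
    \<Rightarrow> ('k, 'f) normed_module \<Rightarrow> ((nat \<Rightarrow> 'e) \<Rightarrow> 'f) \<Rightarrow> real" where
  "type_norm n p E F T = Inf {C. type_const n p E F T C}"

definition cotype_ops ::
  "nat \<Rightarrow> real \<Rightarrow> (nat \<Rightarrow> ('k::real_normed_field, 'e) normed_module)
    \<Rightarrow> ('k, 'f) normed_module \<Rightarrow> ((nat \<Rightarrow> 'e) \<Rightarrow> 'f) set" where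
  "cotype_ops n q E F = {T \<in> multilinear_ops n E F. \<exists>C. cotype_const n q E F T C}"

definition cotype_norm ::
  "nat \<Rightarrow> real \<Rightarrow> (nat \<Rightarrow> ('k::real_normed_field, 'e) normed_module)
    \<Rightarrow> ('k, 'f) normed_module \<Rightarrow> ((nat \<Rightarrow> 'e) \<Rightarrow> 'f) \<Rightarrow> real" where
  "cotype_norm n q E F T = Inf {C. cotype_const n q E F T C}"

text \<open>
  The linear classes are the case \<open>n = 1\<close>: a map \<open>u\<close> on vectors is read as the map
  \<open>\<lambda>x. u (x 1)\<close> on \<open>1\<close>-tuples.
\<close>

definition lin_type_ops ::
  "real \<Rightarrow> ('k::real_normed_field, 'a) normed_module \<Rightarrow> ('k, 'b) normed_module \<Rightarrow> ('a \<Rightarrow> 'b) set"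
  where "lin_type_ops p E F = {u. (\<lambda>x. u (x 1)) \<in> type_ops 1 (\<lambda>_. p) (\<lambda>_. E) F}"

definition lin_type_norm ::
  "real \<Rightarrow> ('k::real_normed_field, 'a) normed_module \<Rightarrow> ('k, 'b) normed_module \<Rightarrow> ('a \<Rightarrow> 'b) \<Rightarrow> real"
  where "lin_type_norm p E F u = type_norm 1 (\<lambda>_. p) (\<lambda>_. E) F (\<lambda>x. u (x 1))"

definition lin_cotype_ops ::
  "real \<Rightarrow> ('k::real_normed_field, 'a) normed_module \<Rightarrow> ('k, 'b) normed_module \<Rightarrow> ('a \<Rightarrow> 'b) set"
  where "lin_cotype_ops q E F = {u. (\<lambda>x. u (x 1)) \<in> cotype_ops 1 q (\<lambda>_. E) F}"

definition lin_cotype_norm ::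
  "real \<Rightarrow> ('k::real_normed_field, 'a) normed_module \<Rightarrow> ('k, 'b) normed_module \<Rightarrow> ('a \<Rightarrow> 'b) \<Rightarrow> real"
  where "lin_cotype_norm q E F u = cotype_norm 1 q (\<lambda>_. E) F (\<lambda>x. u (x 1))"


section \<open>Composition and factorization classes\<close>

text \<open>
  HOL cannot quantify over types inside a formula, so the intermediate spaces range over all
  Banach spaces whose elements are taken from the type \<open>'g\<close>, an explicit parameter. A theorem with
  a free type variable \<open>'g\<close> covers all intermediate spaces: membership is a
  hypothesis, and a lower bound for the infima over every \<open>'g\<close> is a lower bound for
  the infimum over all Banach spaces.

  A class of linear operators \<open>\<I>\<close> and its norm \<open>N\<close> are given by their components, that is, by
  \<open>\<I> G F\<close> and \<open>N G F\<close> for Banach spaces \<open>G\<close> and \<open>F\<close>.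
\<close>

definition left_factorization ::
  "(('k::real_normed_field, 'g) normed_module \<Rightarrow> ('k, 'f) normed_module \<Rightarrow> ('g \<Rightarrow> 'f) set)
    \<Rightarrow> nat \<Rightarrow> (nat \<Rightarrow> ('k, 'e) normed_module) \<Rightarrow> ('k, 'f) normed_module
    \<Rightarrow> ((nat \<Rightarrow> 'e) \<Rightarrow> 'f) \<Rightarrow> ('k, 'g) normed_module \<Rightarrow> ('g \<Rightarrow> 'f) \<Rightarrow> ((nat \<Rightarrow> 'e) \<Rightarrow> 'g) \<Rightarrow> bool" where
  "left_factorization \<I> n E F T G u B \<longleftrightarrow>
     banach_space G \<and> u \<in> \<I> G F \<and> B \<in> multilinear_ops n E G \<and>
     (\<forall>x\<in>tuples n E. T x = u (B x))"

definition comp_ops ::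
  "'g itself \<Rightarrow> (('k::real_normed_field, 'g) normed_module \<Rightarrow> ('k, 'f) normed_module \<Rightarrow> ('g \<Rightarrow> 'f) set)
    \<Rightarrow> nat \<Rightarrow> (nat \<Rightarrow> ('k, 'e) normed_module) \<Rightarrow> ('k, 'f) normed_module
    \<Rightarrow> ((nat \<Rightarrow> 'e) \<Rightarrow> 'f) set" where
  "comp_ops _ \<I> n E F =
     {T \<in> multilinear_ops n E F. \<exists>G u B. left_factorization \<I> n E F T G u B}"

definition comp_norm ::
  "'g itself \<Rightarrow> (('k::real_normed_field, 'g) normed_module \<Rightarrow> ('k, 'f) normed_module \<Rightarrow> ('g \<Rightarrow> 'f) set)
    \<Rightarrow> (('k, 'g) normed_module \<Rightarrow> ('k, 'f) normed_module \<Rightarrow> ('g \<Rightarrow> 'f) \<Rightarrow> real)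
    \<Rightarrow> nat \<Rightarrow> (nat \<Rightarrow> ('k, 'e) normed_module) \<Rightarrow> ('k, 'f) normed_module
    \<Rightarrow> ((nat \<Rightarrow> 'e) \<Rightarrow> 'f) \<Rightarrow> real" where
  "comp_norm _ \<I> N n E F T =
     Inf {op_norm n E G B * N G F u | G u B. left_factorization \<I> n E F T G u B}"

definition right_factorization ::
  "(nat \<Rightarrow> ('k::real_normed_field, 'e) normed_module \<Rightarrow> ('k, 'g) normed_module \<Rightarrow> ('e \<Rightarrow> 'g) set)
    \<Rightarrow> nat \<Rightarrow> (nat \<Rightarrow> ('k, 'e) normed_module) \<Rightarrow> ('k, 'f) normed_module
    \<Rightarrow> ((nat \<Rightarrow> 'e) \<Rightarrow> 'f) \<Rightarrow> (nat \<Rightarrow> ('k, 'g) normed_module) \<Rightarrow> (nat \<Rightarrow> 'e \<Rightarrow> 'g)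
    \<Rightarrow> ((nat \<Rightarrow> 'g) \<Rightarrow> 'f) \<Rightarrow> bool" where
  "right_factorization \<I> n E F T G u B \<longleftrightarrow>
     (\<forall>i\<in>{1..n}. banach_space (G i) \<and> u i \<in> \<I> i (E i) (G i)) \<and> B \<in> multilinear_ops n G F \<and>
     (\<forall>x\<in>tuples n E. T x = B (\<lambda>i\<in>{1..n}. u i (x i)))"

definition fact_ops ::
  "'g itself \<Rightarrow>
    (nat \<Rightarrow> ('k::real_normed_field, 'e) normed_module \<Rightarrow> ('k, 'g) normed_module \<Rightarrow> ('e \<Rightarrow> 'g) set)
    \<Rightarrow> nat \<Rightarrow> (nat \<Rightarrow> ('k, 'e) normed_module) \<Rightarrow> ('k, 'f) normed_module
    \<Rightarrow> ((nat \<Rightarrow> 'e) \<Rightarrow> 'f) set" where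
  "fact_ops _ \<I> n E F =
     {T \<in> multilinear_ops n E F. \<exists>G u B. right_factorization \<I> n E F T G u B}"

definition fact_norm ::
  "'g itself \<Rightarrow>
    (nat \<Rightarrow> ('k::real_normed_field, 'e) normed_module \<Rightarrow> ('k, 'g) normed_module \<Rightarrow> ('e \<Rightarrow> 'g) set)
    \<Rightarrow> (nat \<Rightarrow> ('k, 'e) normed_module \<Rightarrow> ('k, 'g) normed_module \<Rightarrow> ('e \<Rightarrow> 'g) \<Rightarrow> real)
    \<Rightarrow> nat \<Rightarrow> (nat \<Rightarrow> ('k, 'e) normed_module) \<Rightarrow> ('k, 'f) normed_module
    \<Rightarrow> ((nat \<Rightarrow> 'e) \<Rightarrow> 'f) \<Rightarrow> real" where
  "fact_norm _ \<I> N n E F T =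
     Inf {op_norm n G F B * (\<Prod>i=1..n. N i (E i) (G i) (u i)) | G u B.
            right_factorization \<I> n E F T G u B}"

end

theory Submission
  imports Defs
begin

text \<open>
  The Rademacher functions are independent random signs, so every \<open>Rad\<close>-norm is a mean over the
  \<open>2\<^sup>k\<close> choices of signs. For independent signs \<open>\<epsilon>\<close> one has
  \<open>\<Sum>\<^sub>j r\<^sub>j B(x\<^sub>j, y\<^sub>j) = \<bbbE>\<^sub>\<epsilon> \<Sum>\<^sub>j r\<^sub>j \<epsilon>\<^sub>j B(x\<^sub>j, \<Sum>\<^sub>l \<epsilon>\<^sub>l y\<^sub>l)\<close>,
  and \<open>r \<epsilon>\<close> is distributed like \<open>r\<close>. With Jensen's inequality this decouples the arguments of a
  multilinear operator one at a time and gives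
  \<open>\<parallel>(B(x\<^sup>1\<^sub>j, \<dots>, x\<^sup>n\<^sub>j))\<^sub>j\<parallel> \<le> \<parallel>B\<parallel> \<Prod>\<^sub>i \<parallel>(x\<^sup>i\<^sub>j)\<^sub>j\<parallel>\<close> for the \<open>Rad\<close>-norms.
  For the \<open>\<ell>\<^sub>p\<close>-norms the same estimate is the generalized Hoelder inequality. Composing these
  bounds with the type and cotype of the linear factors yields the three inclusions.
\<close>

section \<open>Generalized Hoelder inequality\<close>

text \<open>Jensen's inequality for the convex function \<open>exp\<close> at the points
  \<open>ln (z i)\<close>. These logarithms represent \<open>z i\<close> only when
  \<open>z i > 0\<close>; a vanishing \<open>z i\<close> makes the left side zero and is treated
  first.\<close>

lemma weighted_arith_geo_mean:
  fixes z w :: "'i \<Rightarrow> real"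
  assumes "finite I" "I \<noteq> {}" "\<And>i. i \<in> I \<Longrightarrow> z i \<ge> 0" "\<And>i. i \<in> I \<Longrightarrow> w i > 0" "(\<Sum>i\<in>I. w i) = 1"
  shows "(\<Prod>i\<in>I. z i powr w i) \<le> (\<Sum>i\<in>I. w i * z i)"
proof (cases "\<exists>i\<in>I. z i = 0")
  case True
  then have "(\<Prod>i\<in>I. z i powr w i) = 0"
    using assms(1) by auto
  then show ?thesis
    using assms(3,4) by (fastforce intro!: sum_nonneg mult_nonneg_nonneg simp: less_imp_le)
next
  case False
  then have pos: "z i > 0" if "i \<in> I" for i
    using assms(3)[OF that] that by (metis less_eq_real_def)
  have "(\<Prod>i\<in>I. z i powr w i) = exp (\<Sum>i\<in>I. w i *\<^sub>R ln (z i))"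
    using assms(1) False by (auto simp: exp_sum powr_def intro!: prod.cong)
  also have "\<dots> \<le> (\<Sum>i\<in>I. w i * exp (ln (z i)))"
    by (rule convex_on_sum[OF assms(1,2) exp_convex]) (use assms in \<open>auto simp: less_imp_le\<close>)
  also have "\<dots> = (\<Sum>i\<in>I. w i * z i)"
    using pos by (intro sum.cong) auto
  finally show ?thesis .
qed

text \<open>After each family is divided by its norm \<open>N i\<close>, the weighted mean
  inequality with weights \<open>1 / (s i * \<sigma>)\<close> bounds every summand, and summing over
  \<open>j\<close> gives at most the total weight 1. Multiplying back by \<open>P\<close> gives the
  claim.\<close>

lemma generalized_Holder:
  fixes a :: "'i \<Rightarrow> 'j \<Rightarrow> real" and s :: "'i \<Rightarrow> real" and q :: real
  assumes fin: "finite I" "finite J" and "q > 0"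
    and nonneg: "\<And>i j. i \<in> I \<Longrightarrow> j \<in> J \<Longrightarrow> a i j \<ge> 0"
    and s: "\<And>i. i \<in> I \<Longrightarrow> s i > 0"
    and q: "1 / q \<le> (\<Sum>i\<in>I. 1 / s i)"
  shows "(\<Sum>j\<in>J. (\<Prod>i\<in>I. a i j) powr q) powr (1 / q)
           \<le> (\<Prod>i\<in>I. (\<Sum>j\<in>J. a i j powr s i) powr (1 / s i))"
proof -
  define N where "N i = (\<Sum>j\<in>J. a i j powr s i) powr (1 / s i)" for i
  define P where "P = (\<Prod>i\<in>I. N i)"
  define \<sigma> where "\<sigma> = (\<Sum>i\<in>I. 1 / s i)"
  have "\<sigma> > 0"
    using q \<open>q > 0\<close> by (auto simp: \<sigma>_def intro: less_le_trans[of 0 "1 / q"])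
  then have "I \<noteq> {}"
    by (auto simp: \<sigma>_def)
  have sum_weights: "(\<Sum>i\<in>I. 1 / (s i * \<sigma>)) = 1"
  proof -
    have "(\<Sum>i\<in>I. 1 / (s i * \<sigma>)) = (\<Sum>i\<in>I. 1 / s i) / \<sigma>"
      by (simp add: sum_divide_distrib)
    then show ?thesis
      using \<open>\<sigma> > 0\<close> by (simp flip: \<sigma>_def)
  qed
  have N_nonneg: "N i \<ge> 0" for i
    by (simp add: N_def)
  have N_powr: "N i powr s i = (\<Sum>j\<in>J. a i j powr s i)" if "i \<in> I" for i
    using s[OF that] by (simp add: N_def powr_powr sum_nonneg)
  have a_le: "a i j \<le> N i" if "i \<in> I" "j \<in> J" for i j
  proof -
    have "a i j powr s i \<le> N i powr s i"
      unfolding N_powr[OF that(1)] using that fin by (intro member_le_sum) auto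
    then show ?thesis
      using s[OF that(1)] nonneg[OF that] N_nonneg by (meson not_le powr_less_mono2)
  qed
  show ?thesis
  \<comment> \<open>Normalization divides by \<open>N i\<close>. If some \<open>N i\<close> is zero,
    \<open>a_le\<close> forces that whole family to vanish, and both sides are zero.\<close>
  proof (cases "P = 0")
    case True
    then obtain i where i: "i \<in> I" "N i = 0"
      using fin by (auto simp: P_def)
    have "(\<Prod>i\<in>I. a i j) = 0" if "j \<in> J" for j
      using a_le[OF i(1) that] nonneg[OF i(1) that] i fin by auto
    then show ?thesis
      using True by (simp add: P_def N_def)
  next
    case False
    then have N_pos: "N i > 0" if "i \<in> I" for i
      using that fin N_nonneg[of i] by (auto simp: P_def less_le)
    then have "P > 0"
      by (simp add: P_def prod_pos)
    define b where "b i j = a i j / N i" for i j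
    have b: "0 \<le> b i j" "b i j \<le> 1" if "i \<in> I" "j \<in> J" for i j
      using that nonneg[OF that] N_pos[OF that(1)] a_le[OF that] by (auto simp: b_def)
    have sum_b: "(\<Sum>j\<in>J. b i j powr s i) = 1" if "i \<in> I" for i
    proof -
      have "(\<Sum>j\<in>J. b i j powr s i) = (\<Sum>j\<in>J. a i j powr s i / N i powr s i)"
        using that nonneg N_nonneg by (intro sum.cong) (auto simp: b_def powr_divide)
      then show ?thesis
        unfolding sum_divide_distrib[symmetric] N_powr[OF that, symmetric] using N_pos[OF that] by simp
    qed
    have pt: "(\<Prod>i\<in>I. b i j) powr q \<le> (\<Sum>i\<in>I. 1 / (s i * \<sigma>) * b i j powr s i)" if "j \<in> J" for j
    proof -
      \<comment> \<open>The slack in the exponent condition is absorbed here: the normalized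
        products lie in [0,1], so raising the exponent from \<open>1 / \<sigma>\<close> to
        \<open>q\<close> can only decrease them.\<close>
      have "1 / \<sigma> \<le> q"
        using q \<open>q > 0\<close> \<open>\<sigma> > 0\<close> by (simp add: \<sigma>_def [symmetric] field_simps)
      moreover have "(\<Prod>i\<in>I. b i j) \<le> 1"
        using b that by (intro prod_le_1) auto
      ultimately have "(\<Prod>i\<in>I. b i j) powr q \<le> (\<Prod>i\<in>I. b i j) powr (1 / \<sigma>)"
        using b that by (intro powr_mono') (auto intro: prod_nonneg)
      also have "\<dots> = (\<Prod>i\<in>I. (b i j powr s i) powr (1 / (s i * \<sigma>)))"
        using b that s
        by (subst prod_powr_distrib) (auto simp: powr_powr intro!: prod.cong dest: s)
      also have "\<dots> \<le> (\<Sum>i\<in>I. 1 / (s i * \<sigma>) * b i j powr s i)"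
      proof (rule weighted_arith_geo_mean[OF _ _ _ _ sum_weights])
      qed (use fin \<open>I \<noteq> {}\<close> s \<open>\<sigma> > 0\<close> in auto)
      finally show ?thesis .
    qed
    have "(\<Sum>j\<in>J. (\<Prod>i\<in>I. b i j) powr q) \<le> (\<Sum>j\<in>J. \<Sum>i\<in>I. 1 / (s i * \<sigma>) * b i j powr s i)"
      by (intro sum_mono pt)
    also have "\<dots> = (\<Sum>i\<in>I. 1 / (s i * \<sigma>) * (\<Sum>j\<in>J. b i j powr s i))"
      by (subst sum.swap) (simp add: sum_distrib_left)
    also have "\<dots> = 1"
      using sum_weights by (simp add: sum_b)
    finally have le1: "(\<Sum>j\<in>J. (\<Prod>i\<in>I. b i j) powr q) \<le> 1" .
    have "(\<Prod>i\<in>I. a i j) powr q = P powr q * (\<Prod>i\<in>I. b i j) powr q" if "j \<in> J" for j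
    proof -
      have "(\<Prod>i\<in>I. a i j) = P * (\<Prod>i\<in>I. b i j)"
        unfolding P_def b_def prod.distrib[symmetric] using N_pos
        by (intro prod.cong) (auto dest: N_pos)
      then show ?thesis
        using b that \<open>P > 0\<close> by (simp add: powr_mult prod_nonneg)
    qed
    then have "(\<Sum>j\<in>J. (\<Prod>i\<in>I. a i j) powr q) = P powr q * (\<Sum>j\<in>J. (\<Prod>i\<in>I. b i j) powr q)"
      by (simp add: sum_distrib_left)
    also have "\<dots> \<le> P powr q"
      using mult_left_mono[OF le1, of "P powr q"] by simp
    finally have "(\<Sum>j\<in>J. (\<Prod>i\<in>I. a i j) powr q) powr (1 / q) \<le> (P powr q) powr (1 / q)"
      using \<open>q > 0\<close> by (intro powr_mono2) (auto intro: sum_nonneg)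
    then show ?thesis
      using \<open>P > 0\<close> \<open>q > 0\<close> by (simp add: powr_powr P_def N_def)
  qed
qed

section \<open>The distribution of the Rademacher functions\<close>

text \<open>A sign pattern is encoded by the set of indices with sign -1. Pointwise multiplication
  of patterns then becomes symmetric difference of sets.\<close>

definition sign_of :: "'i set \<Rightarrow> 'i \<Rightarrow> real" where
  "sign_of A j = (if j \<in> A then -1 else 1)"

lemma sign_of_sym_diff: "sign_of (sym_diff A B) j = sign_of A j * sign_of B j"
  by (auto simp: sign_of_def)

text \<open>Symmetric difference with a fixed \<open>B\<close> is an involution of
  \<open>Pow S\<close>. This expresses that multiplying random signs by a fixed pattern preserves
  their distribution.\<close>

lemma sum_sym_diff_reindex:
  assumes "B \<subseteq> S"
  shows "(\<Sum>A\<in>Pow S. f (sym_diff A B)) = (\<Sum>A\<in>Pow S. f A)"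
  by (rule sum.reindex_bij_witness[of _ "\<lambda>A. sym_diff A B" "\<lambda>A. sym_diff A B"])
     (use assms in \<open>auto intro!: arg_cong[of _ _ f]\<close>)

text \<open>For \<open>j \<noteq> l\<close>, flipping the sign at \<open>j\<close> permutes the
  patterns and negates every summand, so the sum equals its own negative.\<close>

lemma sign_of_orthogonal:
  assumes "finite S" "j \<in> S" "l \<in> S"
  shows "(\<Sum>A\<in>Pow S. sign_of A j * sign_of A l) = (if j = l then 2 ^ card S else 0)"
proof (cases "j = l")
  case True
  then show ?thesis
    using assms by (simp add: sign_of_def card_Pow if_distrib cong: if_cong)
next
  case False
  have "(\<Sum>A\<in>Pow S. sign_of A j * sign_of A l)
      = (\<Sum>A\<in>Pow S. sign_of (sym_diff A {j}) j * sign_of (sym_diff A {j}) l)"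
    using assms by (intro sum_sym_diff_reindex[symmetric]) auto
  also have "\<dots> = - (\<Sum>A\<in>Pow S. sign_of A j * sign_of A l)"
    using False by (auto simp: sign_of_sym_diff sign_of_def simp flip: sum_negf intro!: sum.cong)
  finally show ?thesis
    using False by simp
qed

text \<open>Fixing the value 0 outside \<open>{1..k}\<close> makes sequences with the same first
  \<open>k\<close> signs equal as functions, so the distribution can be stated with an arbitrary
  \<open>g\<close> on whole sequences.\<close>

definition restrict_seq :: "nat \<Rightarrow> (nat \<Rightarrow> real) \<Rightarrow> nat \<Rightarrow> real" where
  "restrict_seq k c j = (if j \<in> {1..k} then c j else 0)"

text \<open>Signs are indexed from 1: the new sign enters slot 1, the old ones move up by one, and
  slot 0 keeps the default value of \<open>restrict_seq\<close>.\<close>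

definition prepend :: "real \<Rightarrow> (nat \<Rightarrow> real) \<Rightarrow> nat \<Rightarrow> real" where
  "prepend x c j = (if j = 0 then 0 else if j = 1 then x else c (j - 1))"

text \<open>Halving the argument cancels one factor 2 in the frequency, and the first sign becomes
  that of \<open>sin (pi * t)\<close>. The endpoints are excluded because the sine vanishes
  there.\<close>

lemma rademacher_half:
  assumes "0 < t" "t < 1"
  shows "restrict_seq (Suc k) (\<lambda>j. rademacher j (t / 2)) = prepend 1 (restrict_seq k (\<lambda>j. rademacher j t))"
proof
  fix j
  show "restrict_seq (Suc k) (\<lambda>j. rademacher j (t / 2)) j = prepend 1 (restrict_seq k (\<lambda>j. rademacher j t)) j"
  proof (cases j)
    case (Suc i)
    have "sin (pi * t) > 0"
      using assms by (intro sin_gt_zero) auto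
    moreover have "rademacher (Suc i) (t / 2) = rademacher i t"
      by (simp add: rademacher_def mult.assoc)
    ultimately show ?thesis
      using Suc by (auto simp: restrict_seq_def prepend_def rademacher_def[of 0])
  qed (simp add: restrict_seq_def prepend_def)
qed

text \<open>Compared with the previous lemma, the sine argument gains \<open>2 ^ i * pi\<close>.
  This is a multiple of the period for \<open>i > 0\<close>, whereas for \<open>i = 0\<close> it
  reverses the sign, which yields the prepended -1.\<close>

lemma rademacher_half_shift:
  assumes "0 < t" "t < 1"
  shows "restrict_seq (Suc k) (\<lambda>j. rademacher j ((1 + t) / 2))
       = prepend (-1) (restrict_seq k (\<lambda>j. rademacher j t))"
proof
  fix j
  show "restrict_seq (Suc k) (\<lambda>j. rademacher j ((1 + t) / 2)) j
      = prepend (-1) (restrict_seq k (\<lambda>j. rademacher j t)) j"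
  proof (cases j)
    case (Suc i)
    have eq: "2 ^ Suc i * pi * ((1 + t) / 2) = real (2 ^ i) * pi + 2 ^ i * pi * t"
      by (simp add: field_simps)
    show ?thesis
    proof (cases "i = 0")
      case True
      have "sin (pi * t) > 0"
        using assms by (intro sin_gt_zero) auto
      then show ?thesis
        using True Suc by (simp add: restrict_seq_def prepend_def rademacher_def distrib_left add_divide_distrib)
    next
      case False
      then have "rademacher (Suc i) ((1 + t) / 2) = rademacher i t"
        unfolding rademacher_def eq sin_add sin_npi cos_npi by simp
      then show ?thesis
        using False Suc by (auto simp: restrict_seq_def prepend_def)
    qed
  qed (simp add: restrict_seq_def prepend_def)
qed

lemma restrict_seq_sign_of_image_Suc:
  assumes "A \<subseteq> {1..k}"
  shows "restrict_seq (Suc k) (sign_of (Suc ` A)) = prepend 1 (restrict_seq k (sign_of A))"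
proof
  fix j
  show "restrict_seq (Suc k) (sign_of (Suc ` A)) j = prepend 1 (restrict_seq k (sign_of A)) j"
    using assms by (cases j) (auto simp: restrict_seq_def prepend_def sign_of_def)
qed

lemma restrict_seq_sign_of_insert_1:
  assumes "A \<subseteq> {1..k}"
  shows "restrict_seq (Suc k) (sign_of (insert 1 (Suc ` A))) = prepend (-1) (restrict_seq k (sign_of A))"
proof
  fix j
  show "restrict_seq (Suc k) (sign_of (insert 1 (Suc ` A))) j = prepend (-1) (restrict_seq k (sign_of A)) j"
    using assms by (cases j) (auto simp: restrict_seq_def prepend_def sign_of_def)
qed

text \<open>The subsets of \<open>{1..Suc k}\<close> split according to whether they contain 1. In
  each half, the remaining elements are the image under \<open>Suc\<close> of a subset of
  \<open>{1..k}\<close>.\<close>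

lemma sum_Pow_atLeastAtMost_Suc:
  fixes g :: "(nat \<Rightarrow> real) \<Rightarrow> real"
  shows "(\<Sum>A\<in>Pow {1..Suc k}. g (restrict_seq (Suc k) (sign_of A)))
    = (\<Sum>A\<in>Pow {1..k}. g (prepend 1 (restrict_seq k (sign_of A))))
      + (\<Sum>A\<in>Pow {1..k}. g (prepend (-1) (restrict_seq k (sign_of A))))"
proof -
  have "{1..Suc k} = insert 1 (Suc ` {1..k})"
    by (auto simp: image_iff)
  then have Pow: "Pow {1..Suc k} = image Suc ` Pow {1..k} \<union> (\<lambda>A. insert 1 (Suc ` A)) ` Pow {1..k}"
    by (simp only: Pow_insert image_Pow_surj[OF refl, of Suc "{1..k}", symmetric] image_image)
  have not_mem: "1 \<notin> Suc ` A" if "A \<in> Pow {1..k}" for A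
    using that by auto
  have inj: "inj_on (image Suc) (Pow {1..k})"
    by (simp add: inj_on_def inj_image_eq_iff)
  have inj': "inj_on (\<lambda>A. insert 1 (Suc ` A)) (Pow {1..k})"
    by (intro inj_onI) (metis not_mem insert_ident inj_image_eq_iff inj_Suc)
  show ?thesis
    unfolding Pow
  proof (subst sum.union_disjoint)
    show "image Suc ` Pow {1..k} \<inter> (\<lambda>A. insert 1 (Suc ` A)) ` Pow {1..k} = {}"
      using not_mem by blast
  qed (simp_all add: sum.reindex[OF inj] sum.reindex[OF inj'] restrict_seq_sign_of_image_Suc
      restrict_seq_sign_of_insert_1 del: One_nat_def)
qed

text \<open>The map \<open>t \<mapsto> 2t mod 1\<close> shifts the Rademacher functions by one index.\<close>

lemma has_bochner_integral_rademacher: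
  fixes g :: "(nat \<Rightarrow> real) \<Rightarrow> real"
  shows "has_bochner_integral lborel
     (\<lambda>t. indicator {0..1} t * g (restrict_seq k (\<lambda>j. rademacher j t)))
     ((\<Sum>A\<in>Pow {1..k}. g (restrict_seq k (sign_of A))) / 2 ^ k)"
proof (induction k arbitrary: g)
  case 0
  have "has_bochner_integral lborel (\<lambda>t. indicator {0..1::real} t *\<^sub>R g (\<lambda>_. 0)) (measure lborel {0..1::real} *\<^sub>R g (\<lambda>_. 0))"
    by (rule has_bochner_integral_scaleR_left, rule has_bochner_integral_real_indicator) auto
  then show ?case
    by (simp add: restrict_seq_def)
next
  case (Suc k)
  define h where "h x t = indicator {0..1::real} t * g (prepend x (restrict_seq k (\<lambda>j. rademacher j t)))" for x t
  define I where "I x = (\<Sum>A\<in>Pow {1..k}. g (prepend x (restrict_seq k (sign_of A)))) / 2 ^ k" for x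
  \<comment> \<open>Substitution with slope 2 halves the integral. The choice \<open>c = 0\<close>
    supplies the half interval with first sign 1, and \<open>c = -1\<close> the one with first sign
    -1.\<close>
  have h: "has_bochner_integral lborel (\<lambda>t. h x (c + 2 * t)) (I x / 2)" for x c
  proof -
    have "has_bochner_integral lborel (h x) (I x)"
      unfolding h_def I_def by (rule Suc.IH)
    then show ?thesis
      using lborel_has_bochner_integral_real_affine_iff[of 2 "h x" "I x" c] by simp
  qed
  have "has_bochner_integral lborel (\<lambda>t. h 1 (0 + 2 * t) + h (-1) (-1 + 2 * t)) (I 1 / 2 + I (-1) / 2)"
    by (intro has_bochner_integral_add h)
  also have "I 1 / 2 + I (-1) / 2 = (\<Sum>A\<in>Pow {1..Suc k}. g (restrict_seq (Suc k) (sign_of A))) / 2 ^ Suc k"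
    unfolding sum_Pow_atLeastAtMost_Suc by (simp add: I_def add_divide_distrib)
  finally show ?case
  \<comment> \<open>At 0, 1/2 and 1 sines vanish and at 1/2 the two branches overlap; these three
    points form a null set.\<close>
  proof (rule iffD1[OF has_bochner_integral_discrete_difference[where X = "{0, 1/2, 1}"], rotated -1])
    fix t :: real assume t: "t \<notin> {0, 1/2, 1}"
    consider "t < 0" | "0 < t" "t < 1/2" | "1/2 < t" "t < 1" | "t > 1"
      using t by fastforce
    then show "h 1 (0 + 2 * t) + h (-1) (-1 + 2 * t)
        = indicator {0..1} t * g (restrict_seq (Suc k) (\<lambda>j. rademacher j t))"
    proof cases
      case 2
      then show ?thesis
        using rademacher_half[of "2 * t" k] by (simp add: h_def)
    next
      case 3
      then show ?thesis
        using rademacher_half_shift[of "2 * t - 1" k] by (simp add: h_def)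
    qed (auto simp: h_def)
  qed auto
qed

section \<open>Linear combinations in Banach spaces\<close>

declare One_nat_def [simp del]

section \<open>The scalar field as a ring, and combinations with real coefficients\<close>

lemma carrier_scalars [simp]: "carrier scalars = UNIV"
  by (simp add: scalars_def)

lemma add_scalars [simp]: "a \<oplus>\<^bsub>scalars\<^esub> b = a + b"
  by (simp add: scalars_def)

lemma mult_scalars [simp]: "a \<otimes>\<^bsub>scalars\<^esub> b = a * b"
  by (simp add: scalars_def)

lemma zero_scalars [simp]: "\<zero>\<^bsub>scalars\<^esub> = 0"
  by (simp add: scalars_def)

lemma one_scalars [simp]: "\<one>\<^bsub>scalars\<^esub> = 1"
  by (simp add: scalars_def)

definition lin_comb ::
  "('k::real_normed_field, 'a) normed_module \<Rightarrow> 'i set \<Rightarrow> ('i \<Rightarrow> real) \<Rightarrow> ('i \<Rightarrow> 'a) \<Rightarrow> 'a" where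
  "lin_comb E S c y = (\<Oplus>\<^bsub>E\<^esub>j\<in>S. of_real (c j) \<odot>\<^bsub>E\<^esub> y j)"

text \<open>The second moment of a randomly signed sum, a finite substitute for the square of
  \<open>rad_norm\<close> that turns all later averaging into finite sums.\<close>

definition sign_mean :: "('k::real_normed_field, 'a) normed_module \<Rightarrow> 'i set \<Rightarrow> ('i \<Rightarrow> 'a) \<Rightarrow> real" where
  "sign_mean E S y = (\<Sum>A\<in>Pow S. (vnorm E (lin_comb E S (sign_of A) y))\<^sup>2) / 2 ^ card S"

lemma sign_mean_nonneg: "sign_mean E S y \<ge> 0"
  by (auto simp: sign_mean_def intro!: divide_nonneg_nonneg sum_nonneg)

context banach_space
begin

lemma smult_mem [simp, intro]: "x \<in> carrier E \<Longrightarrow> a \<odot> x \<in> carrier E"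
  by simp

lemma smult_sum_left:
  assumes "finite S" "x \<in> carrier E"
  shows "(\<Sum>i\<in>S. c i) \<odot> x = (\<Oplus>i\<in>S. c i \<odot> x)"
  using assms
proof (induction S rule: finite_induct)
  case empty
  then show ?case
    using smult_l_null[of x] by simp
next
  case (insert i S)
  then show ?case
    using smult_l_distr[of "c i" "sum c S" x] by (simp add: M.finsum_insert)
qed

lemma finsum_smult:
  "\<lbrakk>finite S; f \<in> S \<rightarrow> carrier E\<rbrakk> \<Longrightarrow> a \<odot> (\<Oplus>i\<in>S. f i) = (\<Oplus>i\<in>S. a \<odot> f i)"
  by (rule finsum_smult_ldistr) simp_all

lemma finsum_swap:
  assumes "finite S" "finite S'" "\<And>i j. \<lbrakk>i \<in> S; j \<in> S'\<rbrakk> \<Longrightarrow> f i j \<in> carrier E"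
  shows "(\<Oplus>i\<in>S. \<Oplus>j\<in>S'. f i j) = (\<Oplus>j\<in>S'. \<Oplus>i\<in>S. f i j)"
  using assms(1,3)
proof (induction S rule: finite_induct)
  case empty
  then show ?case
    by (simp add: M.finsum_zero)
next
  case (insert i S)
  have "(\<Oplus>j\<in>S'. \<Oplus>i\<in>insert i S. f i j) = (\<Oplus>j\<in>S'. f i j \<oplus> (\<Oplus>i\<in>S. f i j))"
    using insert by (intro M.finsum_cong') (auto simp: M.finsum_insert Pi_iff intro!: M.finsum_closed)
  also have "\<dots> = (\<Oplus>j\<in>S'. f i j) \<oplus> (\<Oplus>j\<in>S'. \<Oplus>i\<in>S. f i j)"
    using insert.prems by (intro M.finsum_addf) (auto intro!: M.finsum_closed)
  finally show ?case
    using insert by (subst M.finsum_insert) (auto simp: Pi_iff intro!: M.finsum_closed)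
qed

lemma vnorm_finsum_le:
  assumes "finite S" "f \<in> S \<rightarrow> carrier E"
  shows "vnorm E (\<Oplus>i\<in>S. f i) \<le> (\<Sum>i\<in>S. vnorm E (f i))"
  using assms
proof (induction S rule: finite_induct)
  case empty
  then show ?case
    by (simp add: vnorm_zero)
next
  case (insert i S)
  then have "vnorm E (f i \<oplus> (\<Oplus>i\<in>S. f i)) \<le> vnorm E (f i) + vnorm E (\<Oplus>i\<in>S. f i)"
    by (intro vnorm_triangle M.finsum_closed) auto
  with insert show ?case
    by (subst M.finsum_insert) auto
qed

lemma lin_comb_closed [intro]:
  "(\<And>j. j \<in> S \<Longrightarrow> y j \<in> carrier E) \<Longrightarrow> lin_comb E S c y \<in> carrier E"
  unfolding lin_comb_def by (intro M.finsum_closed) auto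

lemma lin_comb_cong:
  assumes "\<And>j. j \<in> S \<Longrightarrow> y' j \<in> carrier E" "\<And>j. j \<in> S \<Longrightarrow> c j = c' j" "\<And>j. j \<in> S \<Longrightarrow> y j = y' j"
  shows "lin_comb E S c y = lin_comb E S c' y'"
  unfolding lin_comb_def using assms by (intro M.finsum_cong') auto

text \<open>This is the algebraic core of the decoupling. Expanding the right side gives a double
  sum over \<open>j\<close> and \<open>l\<close>; summed over \<open>A\<close>, the product of the
  two signs vanishes off the diagonal by \<open>sign_of_orthogonal\<close>.\<close>

lemma sign_average_diagonal:
  assumes S: "finite S" and b: "\<And>j l. \<lbrakk>j \<in> S; l \<in> S\<rbrakk> \<Longrightarrow> b j l \<in> carrier E"
  shows "of_real (2 ^ card S) \<odot> lin_comb E S c (\<lambda>j. b j j)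
    = (\<Oplus>A\<in>Pow S. lin_comb E S (\<lambda>j. c j * sign_of A j) (\<lambda>j. lin_comb E S (sign_of A) (b j)))"
proof -
  define w where "w j l A = c j * (sign_of A j * sign_of A l)" for j l A
  have mem: "of_real (w j l A) \<odot> b j l \<in> carrier E" if "j \<in> S" "l \<in> S" for j l A
    using b[OF that] by simp
  have "(\<Oplus>A\<in>Pow S. lin_comb E S (\<lambda>j. c j * sign_of A j) (\<lambda>j. lin_comb E S (sign_of A) (b j)))
      = (\<Oplus>A\<in>Pow S. \<Oplus>j\<in>S. \<Oplus>l\<in>S. of_real (w j l A) \<odot> b j l)"
  proof (intro M.finsum_cong' refl)
    fix A
    show "lin_comb E S (\<lambda>j. c j * sign_of A j) (\<lambda>j. lin_comb E S (sign_of A) (b j))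
        = (\<Oplus>j\<in>S. \<Oplus>l\<in>S. of_real (w j l A) \<odot> b j l)"
      unfolding lin_comb_def
    proof (intro M.finsum_cong' refl)
      fix j assume j: "j \<in> S"
      show "of_real (c j * sign_of A j) \<odot> (\<Oplus>l\<in>S. of_real (sign_of A l) \<odot> b j l)
          = (\<Oplus>l\<in>S. of_real (w j l A) \<odot> b j l)"
        using j b S mem
        by (subst finsum_smult)
           (auto simp: w_def mult.assoc simp flip: smult_assoc1[simplified] intro!: M.finsum_cong')
    qed (auto intro!: M.finsum_closed mem)
  qed (auto intro!: M.finsum_closed mem)
  \<comment> \<open>Two exchanges move the sum over \<open>A\<close> innermost, where it acts on
    scalars only.\<close>
  also have "\<dots> = (\<Oplus>j\<in>S. \<Oplus>A\<in>Pow S. \<Oplus>l\<in>S. of_real (w j l A) \<odot> b j l)"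
    using S by (intro finsum_swap) (auto intro!: M.finsum_closed mem)
  also have "\<dots> = (\<Oplus>j\<in>S. \<Oplus>l\<in>S. \<Oplus>A\<in>Pow S. of_real (w j l A) \<odot> b j l)"
    using S by (intro M.finsum_cong' refl finsum_swap) (auto intro!: M.finsum_closed mem)
  also have "\<dots> = (\<Oplus>j\<in>S. of_real (2 ^ card S) \<odot> (of_real (c j) \<odot> b j j))"
  proof (intro M.finsum_cong' refl)
    fix j assume j: "j \<in> S"
    have "(\<Oplus>A\<in>Pow S. of_real (w j l A) \<odot> b j l)
        = (if j = l then of_real (2 ^ card S) \<odot> (of_real (c j) \<odot> b j l) else \<zero>)" if l: "l \<in> S" for l
    proof -
      have "(\<Oplus>A\<in>Pow S. of_real (w j l A) \<odot> b j l) = of_real (\<Sum>A\<in>Pow S. w j l A) \<odot> b j l"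
        using S b[OF j l] by (simp add: smult_sum_left)
      also have "(\<Sum>A\<in>Pow S. w j l A) = (if j = l then 2 ^ card S * c j else 0)"
        using sign_of_orthogonal[OF S j l] by (simp add: w_def flip: sum_distrib_left)
      finally show ?thesis
        using b[OF j l] smult_l_null[OF b[OF j l]] smult_assoc1[of "of_real (2 ^ card S)" "of_real (c j)" "b j l"]
        by (cases "j = l") auto
    qed
    then have "(\<Oplus>l\<in>S. \<Oplus>A\<in>Pow S. of_real (w j l A) \<odot> b j l)
        = (\<Oplus>l\<in>S. if j = l then of_real (2 ^ card S) \<odot> (of_real (c j) \<odot> b j l) else \<zero>)"
      using b j by (intro M.finsum_cong') auto
    also have "\<dots> = of_real (2 ^ card S) \<odot> (of_real (c j) \<odot> b j j)"
      by (rule M.add.finprod_singleton) (use S b j in auto)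
    finally show "(\<Oplus>l\<in>S. \<Oplus>A\<in>Pow S. of_real (w j l A) \<odot> b j l)
        = of_real (2 ^ card S) \<odot> (of_real (c j) \<odot> b j j)" .
  qed (use b in auto)
  also have "\<dots> = of_real (2 ^ card S) \<odot> lin_comb E S c (\<lambda>j. b j j)"
    unfolding lin_comb_def using S b by (intro finsum_smult[symmetric]) auto
  finally show ?thesis ..
qed

text \<open>The integrand depends on \<open>t\<close> only through the first \<open>k\<close>
  Rademacher values, whose distribution is uniform on the \<open>2 ^ k\<close> sign
  patterns.\<close>

lemma rad_norm_eq_sign_mean:
  assumes y: "\<And>j. j \<in> {1..k} \<Longrightarrow> y j \<in> carrier E"
  shows "rad_norm E k y = sqrt (sign_mean E {1..k} y)"
proof -
  define g where "g c = (vnorm E (lin_comb E {1..k} c y))\<^sup>2" for c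
  have g: "g (restrict_seq k c) = g c" for c
    unfolding g_def using y
    by (intro arg_cong[of _ _ "\<lambda>x. (vnorm E x)\<^sup>2"] lin_comb_cong) (auto simp: restrict_seq_def)
  have "(LINT t:{0..1}|lborel. g (\<lambda>j. rademacher j t)) = (\<Sum>A\<in>Pow {1..k}. g (sign_of A)) / 2 ^ k"
    using has_bochner_integral_integral_eq[OF has_bochner_integral_rademacher[of g k]]
    by (simp add: set_lebesgue_integral_def g)
  then show ?thesis
    by (simp add: rad_norm_def g_def lin_comb_def sign_mean_def)
qed

end

section \<open>Boundedness of continuous multilinear operators\<close>

locale multilinear_op = F: banach_space F
  for F :: "('k::real_normed_field, 'f) normed_module" +
  fixes n :: nat and E :: "nat \<Rightarrow> ('k, 'e) normed_module" and T :: "(nat \<Rightarrow> 'e) \<Rightarrow> 'f"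
  assumes banach: "i \<in> {1..n} \<Longrightarrow> banach_space (E i)"
    and T_mem: "T \<in> multilinear_ops n E F"
begin

lemma closed [intro]: "x \<in> tuples n E \<Longrightarrow> T x \<in> carrier F"
  using T_mem by (auto simp: multilinear_ops_def)

lemma add:
  "\<lbrakk>x \<in> tuples n E; i \<in> {1..n}; y \<in> carrier (E i); z \<in> carrier (E i)\<rbrakk>
    \<Longrightarrow> T (x(i := y \<oplus>\<^bsub>E i\<^esub> z)) = T (x(i := y)) \<oplus>\<^bsub>F\<^esub> T (x(i := z))"
  using T_mem by (simp add: multilinear_ops_def)

lemma smult:
  "\<lbrakk>x \<in> tuples n E; i \<in> {1..n}; y \<in> carrier (E i)\<rbrakk>
    \<Longrightarrow> T (x(i := a \<odot>\<^bsub>E i\<^esub> y)) = a \<odot>\<^bsub>F\<^esub> T (x(i := y))"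
  using T_mem by (simp add: multilinear_ops_def)

lemma continuous: "continuous_map (product_topology (\<lambda>i. vtopology (E i)) {1..n}) (vtopology F) T"
  using T_mem by (simp add: multilinear_ops_def)

lemma tuple_update:
  "\<lbrakk>x \<in> tuples n E; i \<in> {1..n}; y \<in> carrier (E i)\<rbrakk> \<Longrightarrow> x(i := y) \<in> tuples n E"
  by (auto simp: PiE_iff extensional_def)

lemma zero_closed: "i \<in> {1..n} \<Longrightarrow> \<zero>\<^bsub>E i\<^esub> \<in> carrier (E i)"
proof -
  assume "i \<in> {1..n}"
  then interpret Ei: banach_space "E i" by (rule banach)
  show ?thesis by simp
qed

lemma eq_zero:
  assumes "x \<in> tuples n E" "i \<in> {1..n}" "x i = \<zero>\<^bsub>E i\<^esub>"
  shows "T x = \<zero>\<^bsub>F\<^esub>"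
proof -
  interpret Ei: banach_space "E i" using assms(2) by (rule banach)
  have "T (x(i := 0 \<odot>\<^bsub>E i\<^esub> \<zero>\<^bsub>E i\<^esub>)) = 0 \<odot>\<^bsub>F\<^esub> T (x(i := \<zero>\<^bsub>E i\<^esub>))"
    using assms by (intro smult) auto
  moreover have "x(i := \<zero>\<^bsub>E i\<^esub>) = x"
    using assms(3) by (simp add: fun_upd_idem)
  ultimately show ?thesis
    using F.smult_l_null[of "T x"] Ei.smult_r_null[of 0] closed[OF assms(1)] by simp
qed

text \<open>Induction on \<open>S\<close> with additivity and homogeneity in slot \<open>i\<close>;
  the empty combination is covered by \<open>eq_zero\<close>.\<close>

lemma lin_comb_slot:
  assumes x: "x \<in> tuples n E" and i: "i \<in> {1..n}" and "finite S"
    and "\<And>j. j \<in> S \<Longrightarrow> y j \<in> carrier (E i)"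
  shows "T (x(i := lin_comb (E i) S c y)) = lin_comb F S c (\<lambda>j. T (x(i := y j)))"
  using assms(3,4)
proof (induction S rule: finite_induct)
  case empty
  interpret Ei: banach_space "E i" using i by (rule banach)
  have "T (x(i := \<zero>\<^bsub>E i\<^esub>)) = \<zero>\<^bsub>F\<^esub>"
    by (rule eq_zero[OF tuple_update[OF x i] i]) auto
  then show ?case
    unfolding lin_comb_def Ei.M.finsum_empty F.M.finsum_empty .
next
  case (insert j S)
  interpret Ei: banach_space "E i" using i by (rule banach)
  have Tmem: "T (x(i := y l)) \<in> carrier F" if "l \<in> insert j S" for l
    using insert.prems[OF that] x i by (intro closed tuple_update)
  have "lin_comb (E i) (insert j S) c y = of_real (c j) \<odot>\<^bsub>E i\<^esub> y j \<oplus>\<^bsub>E i\<^esub> lin_comb (E i) S c y"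
    unfolding lin_comb_def using insert by (intro Ei.M.finsum_insert) auto
  moreover have "lin_comb F (insert j S) c (\<lambda>j. T (x(i := y j)))
      = of_real (c j) \<odot>\<^bsub>F\<^esub> T (x(i := y j)) \<oplus>\<^bsub>F\<^esub> lin_comb F S c (\<lambda>j. T (x(i := y j)))"
    unfolding lin_comb_def using insert.hyps Tmem by (intro F.M.finsum_insert) auto
  moreover have "T (x(i := of_real (c j) \<odot>\<^bsub>E i\<^esub> y j \<oplus>\<^bsub>E i\<^esub> lin_comb (E i) S c y))
      = of_real (c j) \<odot>\<^bsub>F\<^esub> T (x(i := y j)) \<oplus>\<^bsub>F\<^esub> T (x(i := lin_comb (E i) S c y))"
    using insert.prems x i by (subst add) (auto simp: smult[OF x i])
  moreover have "T (x(i := lin_comb (E i) S c y)) = lin_comb F S c (\<lambda>j. T (x(i := y j)))"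
    using insert.IH insert.prems by blast
  ultimately show ?case
    by metis
qed

lemma scale_all:
  assumes x: "x \<in> tuples n E"
  shows "T (\<lambda>i\<in>{1..n}. c i \<odot>\<^bsub>E i\<^esub> x i) = (\<Prod>i=1..n. c i) \<odot>\<^bsub>F\<^esub> T x"
proof -
  \<comment> \<open>Interpolates between the two tuples: passing from \<open>m\<close> to
    \<open>Suc m\<close> scales exactly one slot, so homogeneity applies.\<close>
  define y where "y m = (\<lambda>i\<in>{1..n}. if i \<le> m then c i \<odot>\<^bsub>E i\<^esub> x i else x i)" for m
  have y: "y m \<in> tuples n E" for m
    using x by (auto simp: y_def PiE_iff intro!: banach_space.smult_mem[OF banach])
  have "T (y m) = (\<Prod>i=1..m. c i) \<odot>\<^bsub>F\<^esub> T x" if "m \<le> n" for m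
    using that
  proof (induction m)
    case 0
    have "y 0 = x"
      using x by (auto simp: y_def fun_eq_iff PiE_iff extensional_def)
    then show ?case
      using closed[OF x] F.smult_one by simp
  next
    case (Suc m)
    have "y (Suc m) = (y m)(Suc m := c (Suc m) \<odot>\<^bsub>E (Suc m)\<^esub> x (Suc m))"
      using Suc.prems by (auto simp: y_def fun_eq_iff)
    then have "T (y (Suc m)) = c (Suc m) \<odot>\<^bsub>F\<^esub> T ((y m)(Suc m := x (Suc m)))"
      using Suc.prems x y[of m] smult[of "y m" "Suc m" "x (Suc m)" "c (Suc m)"] by (auto simp: PiE_iff)
    also have "(y m)(Suc m := x (Suc m)) = y m"
      using Suc.prems by (auto simp: y_def fun_eq_iff)
    finally show ?case
      using Suc closed[OF x] F.smult_assoc1[of "c (Suc m)" "\<Prod>i=1..m. c i" "T x"]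
      by (simp add: mult.commute)
  qed
  moreover have "y n = (\<lambda>i\<in>{1..n}. c i \<odot>\<^bsub>E i\<^esub> x i)"
    by (auto simp: y_def fun_eq_iff)
  ultimately show ?thesis
    by (metis order_refl)
qed

text \<open>By continuity at the zero tuple \<open>z\<close>, the preimage of the unit ball around
  \<open>T z\<close> contains an open box around \<open>z\<close>, hence all tuples with
  sufficiently small entries.\<close>

lemma locally_bounded:
  obtains \<delta> K where "\<delta> > 0"
    "\<And>x. \<lbrakk>x \<in> tuples n E; \<And>i. i \<in> {1..n} \<Longrightarrow> vnorm (E i) (x i) < \<delta>\<rbrakk> \<Longrightarrow> vnorm F (T x) \<le> K"
proof -
  interpret FM: Metric_space "carrier F" "vdist F" by (rule F.Metric_space_vdist)
  have ms: "Metric_space (carrier (E i)) (vdist (E i))" if "i \<in> {1..n}" for i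
    using that by (intro banach_space.Metric_space_vdist banach)
  define z where "z = (\<lambda>i\<in>{1..n}. \<zero>\<^bsub>E i\<^esub>)"
  have z: "z \<in> tuples n E"
    using zero_closed by (auto simp: z_def)
  have top: "topspace (product_topology (\<lambda>i. vtopology (E i)) {1..n}) = tuples n E"
    using Metric_space.topspace_mtopology[OF ms] by (auto simp: PiE_iff)
  let ?V = "{x \<in> tuples n E. T x \<in> FM.mball (T z) 1}"
  have V: "openin (product_topology (\<lambda>i. vtopology (E i)) {1..n}) ?V"
    using openin_continuous_map_preimage[OF continuous FM.openin_mball] unfolding top .
  have zV: "z \<in> ?V"
    using z closed[OF z] by simp
  obtain U where U: "\<forall>i\<in>{1..n}. openin (vtopology (E i)) (U i)"
      "z \<in> Pi\<^sub>E {1..n} U" "Pi\<^sub>E {1..n} U \<subseteq> ?V"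
    using bspec[OF V[unfolded openin_product_topology_alt] zV] by (elim exE conjE)
  have "\<exists>r>0. \<forall>x\<in>carrier (E i). vnorm (E i) x < r \<longrightarrow> x \<in> U i" if i: "i \<in> {1..n}" for i
  proof -
    interpret Ei: banach_space "E i" using i by (rule banach)
    interpret M: Metric_space "carrier (E i)" "vdist (E i)" by (rule Ei.Metric_space_vdist)
    have "\<zero>\<^bsub>E i\<^esub> \<in> U i"
      using PiE_mem[OF U(2) i] i by (simp add: z_def)
    with bspec[OF U(1) i] obtain r where "r > 0" "M.mball \<zero>\<^bsub>E i\<^esub> r \<subseteq> U i"
      unfolding M.openin_mtopology by metis
    moreover have "x \<in> M.mball \<zero>\<^bsub>E i\<^esub> r" if "x \<in> carrier (E i)" "vnorm (E i) x < r" for x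
      using that by (simp add: vdist_def Ei.M.minus_eq Ei.vnorm_minus)
    ultimately show ?thesis
      by blast
  qed
  then obtain r where r: "\<And>i. i \<in> {1..n} \<Longrightarrow> r i > 0"
      "\<And>i x. \<lbrakk>i \<in> {1..n}; x \<in> carrier (E i); vnorm (E i) x < r i\<rbrakk> \<Longrightarrow> x \<in> U i"
    by metis
  \<comment> \<open>The inserted 1 keeps the set nonempty when \<open>n = 0\<close>.\<close>
  define \<delta> where "\<delta> = Min (insert 1 (r ` {1..n}))"
  show thesis
  proof (rule that[of \<delta> "1 + vnorm F (T z)"])
    show "\<delta> > 0"
      using r(1) by (simp add: \<delta>_def)
    fix x assume x: "x \<in> tuples n E" "\<And>i. i \<in> {1..n} \<Longrightarrow> vnorm (E i) (x i) < \<delta>"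
    have "x i \<in> U i" if i: "i \<in> {1..n}" for i
    proof (rule r(2)[OF i])
      have "\<delta> \<le> r i"
        unfolding \<delta>_def using i by (intro Min_le) auto
      then show "vnorm (E i) (x i) < r i"
        using x(2)[OF i] by simp
    qed (use x i in auto)
    then have "x \<in> Pi\<^sub>E {1..n} U"
      using x(1) by (auto simp: PiE_iff)
    then have "vdist F (T z) (T x) < 1"
      using U(3) by auto
    then have d: "vnorm F (T x \<ominus>\<^bsub>F\<^esub> T z) < 1"
      using FM.commute[of "T z" "T x"] closed[OF x(1)] closed[OF z] by (simp add: vdist_def)
    have "T x = (T x \<ominus>\<^bsub>F\<^esub> T z) \<oplus>\<^bsub>F\<^esub> T z"
      using closed[OF x(1)] closed[OF z] by (simp add: F.M.minus_eq F.M.a_assoc F.M.l_neg)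
    then show "vnorm F (T x) \<le> 1 + vnorm F (T z)"
      using F.vnorm_triangle[of "T x \<ominus>\<^bsub>F\<^esub> T z" "T z"] d closed[OF x(1)] closed[OF z] by simp
  qed
qed

text \<open>Makes the supremum in \<open>op_norm\<close> meaningful. Scaling all entries by
  \<delta>/2 moves the closed unit balls strictly inside the neighbourhood of
  \<open>locally_bounded\<close>, and \<open>scale_all\<close> accounts for the factor
  (\<delta>/2)^n.\<close>

lemma bdd_above_unit_ball:
  "bdd_above ((\<lambda>x. vnorm F (T x)) ` {x \<in> tuples n E. \<forall>i\<in>{1..n}. vnorm (E i) (x i) \<le> 1})"
proof -
  obtain \<delta> K where \<delta>: "\<delta> > 0"
    "\<And>x. \<lbrakk>x \<in> tuples n E; \<And>i. i \<in> {1..n} \<Longrightarrow> vnorm (E i) (x i) < \<delta>\<rbrakk> \<Longrightarrow> vnorm F (T x) \<le> K"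
    using locally_bounded by blast
  show ?thesis
  proof (rule bdd_aboveI2)
    fix x assume x: "x \<in> {x \<in> tuples n E. \<forall>i\<in>{1..n}. vnorm (E i) (x i) \<le> 1}"
    define y where "y = (\<lambda>i\<in>{1..n}. of_real (\<delta> / 2) \<odot>\<^bsub>E i\<^esub> x i)"
    have "vnorm F (T y) \<le> K"
    proof (rule \<delta>(2))
      fix i assume i: "i \<in> {1..n}"
      then interpret Ei: banach_space "E i" by (rule banach)
      have "vnorm (E i) (y i) = \<delta> / 2 * vnorm (E i) (x i)"
        using i x \<delta>(1) by (auto simp: y_def Ei.vnorm_smult PiE_iff)
      also have "\<dots> \<le> \<delta> / 2 * 1"
        using i x \<delta>(1) by (intro mult_left_mono) auto
      finally show "vnorm (E i) (y i) < \<delta>"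
        using \<delta>(1) by simp
    qed (use x in \<open>auto simp: y_def PiE_iff intro!: banach_space.smult_mem[OF banach]\<close>)
    moreover have "vnorm F (T y) = (\<delta> / 2) ^ n * vnorm F (T x)"
      using x \<delta>(1) closed[of x] unfolding y_def
      by (subst scale_all) (auto simp: F.vnorm_smult norm_power simp flip: of_real_divide)
    ultimately show "vnorm F (T x) \<le> K / (\<delta> / 2) ^ n"
      using \<delta>(1) by (simp add: field_simps)
  qed
qed

lemma unit_ball_le_op_norm:
  "\<lbrakk>x \<in> tuples n E; \<And>i. i \<in> {1..n} \<Longrightarrow> vnorm (E i) (x i) \<le> 1\<rbrakk> \<Longrightarrow> vnorm F (T x) \<le> op_norm n E F T"
  unfolding op_norm_def by (intro cSUP_upper bdd_above_unit_ball) auto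

lemma op_norm_nonneg: "0 \<le> op_norm n E F T"
proof -
  define z where "z = (\<lambda>i\<in>{1..n}. \<zero>\<^bsub>E i\<^esub>)"
  have z: "z \<in> tuples n E"
    using zero_closed by (auto simp: z_def)
  then have "0 \<le> vnorm F (T z)"
    by (intro F.vnorm_nonneg closed)
  also have "\<dots> \<le> op_norm n E F T"
    using z by (intro unit_ball_le_op_norm) (auto simp: z_def banach_space.vnorm_zero[OF banach])
  finally show ?thesis .
qed

text \<open>Dividing each entry by its norm reduces to the unit balls. If an entry has norm zero, it
  is the zero vector and both sides vanish.\<close>

lemma vnorm_le_op_norm:
  assumes x: "x \<in> tuples n E"
  shows "vnorm F (T x) \<le> op_norm n E F T * (\<Prod>i=1..n. vnorm (E i) (x i))"
proof (cases "\<exists>i\<in>{1..n}. vnorm (E i) (x i) = 0")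
  case True
  then obtain i where i: "i \<in> {1..n}" "vnorm (E i) (x i) = 0"
    by blast
  have "x i = \<zero>\<^bsub>E i\<^esub>"
    using i(2) by (rule banach_space.vnorm_eq_zero[OF banach[OF i(1)] PiE_mem[OF x i(1)]])
  then have "T x = \<zero>\<^bsub>F\<^esub>"
    using eq_zero[OF x i(1)] by simp
  moreover have "(\<Prod>i=1..n. vnorm (E i) (x i)) = 0"
    using i by auto
  ultimately show ?thesis
    by (metis F.vnorm_zero mult_zero_right order_refl)
next
  case False
  have pos: "vnorm (E i) (x i) > 0" if "i \<in> {1..n}" for i
    using False that x banach_space.vnorm_nonneg[OF banach, of i "x i"] by (auto simp: less_le PiE_iff)
  define y where "y = (\<lambda>i\<in>{1..n}. of_real (inverse (vnorm (E i) (x i))) \<odot>\<^bsub>E i\<^esub> x i)"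
  have y: "y \<in> tuples n E"
    using x by (auto simp: y_def PiE_iff intro!: banach_space.smult_mem[OF banach])
  have "vnorm (E i) (y i) \<le> 1" if i: "i \<in> {1..n}" for i
  proof -
    interpret Ei: banach_space "E i" using i by (rule banach)
    have "x i \<in> carrier (E i)"
      by (rule PiE_mem[OF x i])
    then show ?thesis
      using pos[OF i] i by (simp add: y_def Ei.vnorm_smult norm_inverse)
  qed
  then have "vnorm F (T y) \<le> op_norm n E F T"
    by (intro unit_ball_le_op_norm y)
  moreover have "vnorm F (T y) = \<bar>\<Prod>i=1..n. inverse (vnorm (E i) (x i))\<bar> * vnorm F (T x)"
    unfolding y_def scale_all[OF x] F.vnorm_smult[OF closed[OF x]] norm_of_real of_real_prod[symmetric] ..
  moreover have "(\<Prod>i=1..n. vnorm (E i) (x i)) > 0"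
    using pos by (intro prod_pos) auto
  moreover have "(\<Prod>i=1..n. inverse (vnorm (E i) (x i))) = inverse (\<Prod>i=1..n. vnorm (E i) (x i))"
    using prod_inversef[of "\<lambda>i. vnorm (E i) (x i)" "{1..n}"] by (simp add: o_def)
  ultimately show ?thesis
    by (simp add: field_simps)
qed

end

section \<open>Decoupling\<close>

text \<open>Replaces the common index of the diagonal by two independent sets of signs. The triangle
  inequality and Cauchy-Schwarz are applied to \<open>sign_average_diagonal\<close>, and invariance
  of the sign distribution removes the coupling of \<open>A'\<close> with \<open>A\<close>.\<close>

lemma (in banach_space) sign_mean_diagonal_le:
  assumes S: "finite S" and b: "\<And>j l. \<lbrakk>j \<in> S; l \<in> S\<rbrakk> \<Longrightarrow> b j l \<in> carrier E"
  shows "sign_mean E S (\<lambda>j. b j j)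
    \<le> (\<Sum>A\<in>Pow S. sign_mean E S (\<lambda>j. lin_comb E S (sign_of A) (b j))) / 2 ^ card S"
proof -
  define N where "N A c = vnorm E (lin_comb E S c (\<lambda>j. lin_comb E S (sign_of A) (b j)))" for A c
  define v where "v A = vnorm E (lin_comb E S (sign_of A) (\<lambda>j. b j j))" for A
  define P :: real where "P = 2 ^ card S"
  have P: "P > 0" "P = real (card (Pow S))"
    using S by (simp_all add: P_def card_Pow)
  have closed: "lin_comb E S c (\<lambda>j. lin_comb E S (sign_of A) (b j)) \<in> carrier E" for c A
    using b by (intro lin_comb_closed) auto
  have v_le: "(v A')\<^sup>2 \<le> (\<Sum>A\<in>Pow S. (N A (sign_of (sym_diff A' A)))\<^sup>2) / P" for A'
  proof -
    have "P * v A' = vnorm E (of_real (2 ^ card S) \<odot> lin_comb E S (sign_of A') (\<lambda>j. b j j))"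
      using b by (subst vnorm_smult) (auto simp: P_def v_def norm_power)
    also have "\<dots> \<le> (\<Sum>A\<in>Pow S. N A (\<lambda>j. sign_of A' j * sign_of A j))"
      unfolding N_def using S b closed
      by (subst sign_average_diagonal) (auto intro!: vnorm_finsum_le)
    also have "\<dots> = (\<Sum>A\<in>Pow S. N A (sign_of (sym_diff A' A)))"
      by (simp add: sign_of_sym_diff[abs_def])
    finally have "(P * v A')\<^sup>2 \<le> (\<Sum>A\<in>Pow S. N A (sign_of (sym_diff A' A)))\<^sup>2"
      using P(1) b by (intro power_mono) (auto simp: v_def intro!: mult_nonneg_nonneg vnorm_nonneg)
    \<comment> \<open>Cauchy-Schwarz against the constant 1, with \<open>P\<close> the number of
      patterns.\<close>
    also have "\<dots> \<le> (\<Sum>A\<in>Pow S. (N A (sign_of (sym_diff A' A)))\<^sup>2) * P"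
      unfolding P(2) by (rule sum_squared_le_sum_of_squares)
    finally show ?thesis
      using P(1) by (simp add: power_mult_distrib power2_eq_square[of P] field_simps)
  qed
  have "sign_mean E S (\<lambda>j. b j j) * P = (\<Sum>A'\<in>Pow S. (v A')\<^sup>2)"
    by (simp add: sign_mean_def v_def P_def)
  also have "\<dots> \<le> (\<Sum>A'\<in>Pow S. (\<Sum>A\<in>Pow S. (N A (sign_of (sym_diff A' A)))\<^sup>2) / P)"
    by (intro sum_mono v_le)
  also have "\<dots> = (\<Sum>A\<in>Pow S. (\<Sum>A'\<in>Pow S. (N A (sign_of (sym_diff A' A)))\<^sup>2) / P)"
    unfolding sum_divide_distrib[symmetric] by (subst sum.swap) simp
  \<comment> \<open>For fixed \<open>A\<close>, the set \<open>sym_diff A' A\<close> runs through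
    all patterns as \<open>A'\<close> does.\<close>
  also have "\<dots> = (\<Sum>A\<in>Pow S. (\<Sum>A'\<in>Pow S. (N A (sign_of A'))\<^sup>2) / P)"
    by (intro sum.cong refl arg_cong[of _ _ "\<lambda>x. x / P"] sum_sym_diff_reindex) auto
  also have "\<dots> = (\<Sum>A\<in>Pow S. sign_mean E S (\<lambda>j. lin_comb E S (sign_of A) (b j)))"
    by (simp add: sign_mean_def N_def P_def)
  finally show ?thesis
    using P(1) by (simp add: P_def field_simps)
qed

text \<open>Induction on the number \<open>m\<close> of slots that depend on \<open>j\<close>, the
  others being frozen at a tuple \<open>w\<close>. One slot is linear and needs only the operator
  norm; each further slot is detached by \<open>sign_mean_diagonal_le\<close>.\<close>

lemma (in multilinear_op) sign_mean_le:
  assumes "1 \<le> n" and S: "finite S"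
    and y: "\<And>i j. \<lbrakk>i \<in> {1..n}; j \<in> S\<rbrakk> \<Longrightarrow> y i j \<in> carrier (E i)"
  shows "sign_mean F S (\<lambda>j. T (\<lambda>i\<in>{1..n}. y i j))
    \<le> (op_norm n E F T)\<^sup>2 * (\<Prod>i=1..n. sign_mean (E i) S (y i))"
proof -
  define K where "K = op_norm n E F T"
  define mixed where "mixed m w j = (\<lambda>i\<in>{1..n}. if i \<le> m then y i j else w i)" for m w j
  \<comment> \<open>Slot \<open>m\<close> is left out because its factor is displayed separately in
    the claim. Slots before it contribute sign means, and slots after it the norms of frozen
    entries.\<close>
  define rest where "rest m w
    = (\<Prod>i\<in>{1..n} - {m}. if i < m then sign_mean (E i) S (y i) else (vnorm (E i) (w i))\<^sup>2)" for m w
  have "sign_mean F S (\<lambda>j. T (mixed m w j)) \<le> K\<^sup>2 * sign_mean (E m) S (y m) * rest m w"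
    if "1 \<le> m" "m \<le> n" "w \<in> tuples n E" for m w
    using that
  proof (induction m arbitrary: w rule: dec_induct)
    case base
    have 1: "1 \<in> {1..n}"
      using \<open>1 \<le> n\<close> by simp
    have eq: "mixed 1 w j = w(1 := y 1 j)" for j
      using base 1 by (auto simp: mixed_def fun_eq_iff PiE_iff extensional_def)
    have "(vnorm F (lin_comb F S (sign_of A) (\<lambda>j. T (mixed 1 w j))))\<^sup>2
        \<le> K\<^sup>2 * (vnorm (E 1) (lin_comb (E 1) S (sign_of A) (y 1)))\<^sup>2 * rest 1 w" for A
    proof -
      define z where "z = lin_comb (E 1) S (sign_of A) (y 1)"
      have z: "z \<in> carrier (E 1)"
        unfolding z_def using y 1 by (intro banach_space.lin_comb_closed[OF banach]) auto
      have w': "w(1 := z) \<in> tuples n E"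
        using base 1 z by (intro tuple_update)
      have "lin_comb F S (sign_of A) (\<lambda>j. T (mixed 1 w j)) = T (w(1 := z))"
        \<comment> \<open>With only slot 1 varying, linearity carries the signed sum inside the
          operator.\<close>
        unfolding z_def eq using base 1 S y by (intro lin_comb_slot[symmetric]) auto
      also have "(vnorm F \<dots>)\<^sup>2 \<le> (K * (\<Prod>i=1..n. vnorm (E i) ((w(1 := z)) i)))\<^sup>2"
        unfolding K_def using w' by (intro power_mono vnorm_le_op_norm F.vnorm_nonneg closed)
      also have "\<dots> = K\<^sup>2 * (\<Prod>i=1..n. (vnorm (E i) ((w(1 := z)) i))\<^sup>2)"
        by (simp add: power_mult_distrib prod_power_distrib)
      also have "(\<Prod>i=1..n. (vnorm (E i) ((w(1 := z)) i))\<^sup>2) = (vnorm (E 1) z)\<^sup>2 * rest 1 w"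
        unfolding rest_def using 1
        by (subst prod.remove[of _ 1]) (auto intro!: arg_cong2[of _ _ _ _ "(*)"] prod.cong)
      finally show ?thesis
        by (simp add: z_def mult.assoc)
    qed
    then have "(\<Sum>A\<in>Pow S. (vnorm F (lin_comb F S (sign_of A) (\<lambda>j. T (mixed 1 w j))))\<^sup>2)
        \<le> (\<Sum>A\<in>Pow S. K\<^sup>2 * (vnorm (E 1) (lin_comb (E 1) S (sign_of A) (y 1)))\<^sup>2 * rest 1 w)"
      by (intro sum_mono)
    then show ?case
      by (simp add: sign_mean_def divide_right_mono flip: sum_distrib_left sum_distrib_right)
  next
    case (step m)
    define M where "M = Suc m"
    have M: "M \<in> {1..n}"
      using step by (simp add: M_def)
    interpret EM: banach_space "E M" using M by (rule banach)
    \<comment> \<open>Slot \<open>M\<close> receives its own index \<open>l\<close>, so the family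
      to be estimated is the diagonal of \<open>b\<close>.\<close>
    define b where "b j l = T ((mixed m w j)(M := y M l))" for j l
    define z where "z A = lin_comb (E M) S (sign_of A) (y M)" for A
    have z: "z A \<in> carrier (E M)" for A
      unfolding z_def using y M by (intro EM.lin_comb_closed) auto
    have mixed: "mixed m w j \<in> tuples n E" if "j \<in> S" for j
      using step.prems y that by (auto simp: mixed_def PiE_iff)
    have b: "b j l \<in> carrier F" if "j \<in> S" "l \<in> S" for j l
      unfolding b_def using mixed that M y by (intro closed tuple_update) auto
    \<comment> \<open>Summing over \<open>l\<close> with the signs of \<open>A\<close> freezes slot
      \<open>M\<close> at \<open>z A\<close>. The induction hypothesis then applies to the updated
      tuple, which is why \<open>w\<close> is arbitrary in the induction.\<close>
    have slot: "lin_comb F S (sign_of A) (b j) = T (mixed m (w(M := z A)) j)" if "j \<in> S" for A j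
    proof -
      have "mixed m (w(M := z A)) j = (mixed m w j)(M := z A)"
        using M by (auto simp: mixed_def fun_eq_iff M_def)
      then show ?thesis
        unfolding b_def z_def using mixed[OF that] M S y by (subst lin_comb_slot[symmetric]) auto
    qed
    have le: "sign_mean F S (\<lambda>j. lin_comb F S (sign_of A) (b j)) \<le> K\<^sup>2 * (vnorm (E M) (z A))\<^sup>2 * rest M w" for A
    proof -
      have w': "w(M := z A) \<in> tuples n E"
        using step.prems M z by (intro tuple_update)
      have "lin_comb F S c (\<lambda>j. lin_comb F S (sign_of A) (b j)) = lin_comb F S c (\<lambda>j. T (mixed m (w(M := z A)) j))" for c
        by (rule F.lin_comb_cong) (use slot b in \<open>auto simp flip: slot\<close>)
      then have "sign_mean F S (\<lambda>j. lin_comb F S (sign_of A) (b j))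
          = sign_mean F S (\<lambda>j. T (mixed m (w(M := z A)) j))"
        by (simp add: sign_mean_def)
      also have "\<dots> \<le> K\<^sup>2 * sign_mean (E m) S (y m) * rest m (w(M := z A))"
        using step.prems(1) by (intro step.IH w') simp
      \<comment> \<open>Merging the factors into one product over all slots makes it possible to
        split off slot \<open>M\<close> in place of slot \<open>m\<close>.\<close>
      also have "sign_mean (E m) S (y m) * rest m (w(M := z A))
          = (\<Prod>i=1..n. if i \<le> m then sign_mean (E i) S (y i) else (vnorm (E i) ((w(M := z A)) i))\<^sup>2)"
        unfolding rest_def using step.hyps step.prems
        by (subst prod.remove[of "{1..n}" m]) (auto simp: le_less intro!: arg_cong2[of _ _ _ _ "(*)"] prod.cong)
      then have "K\<^sup>2 * sign_mean (E m) S (y m) * rest m (w(M := z A))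
          = K\<^sup>2 * (\<Prod>i=1..n. if i \<le> m then sign_mean (E i) S (y i) else (vnorm (E i) ((w(M := z A)) i))\<^sup>2)"
        by (simp add: mult.assoc)
      also have "(\<Prod>i=1..n. if i \<le> m then sign_mean (E i) S (y i) else (vnorm (E i) ((w(M := z A)) i))\<^sup>2)
          = (vnorm (E M) (z A))\<^sup>2 * rest M w"
        unfolding rest_def using M
        by (subst prod.remove[of "{1..n}" M]) (auto simp: M_def less_Suc_eq_le split: if_splits intro!: arg_cong2[of _ _ _ _ "(*)"] prod.cong)
      finally show ?thesis
        by (simp add: mult.assoc)
    qed
    have "mixed M w j = (mixed m w j)(M := y M j)" for j
      using M by (auto simp: mixed_def fun_eq_iff M_def)
    then have "sign_mean F S (\<lambda>j. T (mixed M w j)) = sign_mean F S (\<lambda>j. b j j)"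
      by (simp add: b_def)
    also have "\<dots> \<le> (\<Sum>A\<in>Pow S. sign_mean F S (\<lambda>j. lin_comb F S (sign_of A) (b j))) / 2 ^ card S"
      using S b by (rule F.sign_mean_diagonal_le)
    also have "\<dots> \<le> (\<Sum>A\<in>Pow S. K\<^sup>2 * (vnorm (E M) (z A))\<^sup>2 * rest M w) / 2 ^ card S"
      by (intro divide_right_mono sum_mono le) auto
    also have "\<dots> = K\<^sup>2 * sign_mean (E M) S (y M) * rest M w"
      by (simp add: sign_mean_def z_def flip: sum_distrib_left sum_distrib_right)
    finally show ?case
      unfolding M_def .
  qed
  note claim = this
  \<comment> \<open>A filler: for \<open>m = n\<close> no slot is frozen, so neither
    \<open>mixed\<close> nor \<open>rest\<close> reads an entry of \<open>w\<close>.\<close>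
  define w where "w = (\<lambda>i\<in>{1..n}. \<zero>\<^bsub>E i\<^esub>)"
  have w: "w \<in> tuples n E"
    using zero_closed by (auto simp: w_def)
  have "mixed n w j = (\<lambda>i\<in>{1..n}. y i j)" for j
    by (auto simp: mixed_def)
  moreover have "(\<Prod>i=1..n. sign_mean (E i) S (y i)) = sign_mean (E n) S (y n) * rest n w"
    unfolding rest_def using \<open>1 \<le> n\<close>
    by (subst prod.remove[of "{1..n}" n]) (auto intro!: arg_cong2[of _ _ _ _ "(*)"] prod.cong)
  ultimately show ?thesis
    using claim[OF \<open>1 \<le> n\<close> order_refl w] by (simp add: K_def mult.assoc)
qed

lemma (in multilinear_op) rad_norm_le:
  assumes "1 \<le> n" and y: "\<And>i j. \<lbrakk>i \<in> {1..n}; j \<in> {1..k}\<rbrakk> \<Longrightarrow> y i j \<in> carrier (E i)"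
  shows "rad_norm F k (\<lambda>j. T (\<lambda>i\<in>{1..n}. y i j)) \<le> op_norm n E F T * (\<Prod>i=1..n. rad_norm (E i) k (y i))"
proof -
  have "(op_norm n E F T * (\<Prod>i=1..n. sqrt (sign_mean (E i) {1..k} (y i))))\<^sup>2
      = (op_norm n E F T)\<^sup>2 * (\<Prod>i=1..n. sign_mean (E i) {1..k} (y i))"
    by (simp add: power_mult_distrib prod_power_distrib sign_mean_nonneg)
  then have "sqrt (sign_mean F {1..k} (\<lambda>j. T (\<lambda>i\<in>{1..n}. y i j)))
      \<le> op_norm n E F T * (\<Prod>i=1..n. sqrt (sign_mean (E i) {1..k} (y i)))"
    using sign_mean_le[OF \<open>1 \<le> n\<close> _ y, of "{1..k}"]
    by (intro real_le_lsqrt mult_nonneg_nonneg op_norm_nonneg prod_nonneg) (auto simp: sign_mean_nonneg)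
  moreover have "rad_norm (E i) k (y i) = sqrt (sign_mean (E i) {1..k} (y i))" if "i \<in> {1..n}" for i
    using banach_space.rad_norm_eq_sign_mean[OF banach[OF that]] y[OF that] by blast
  moreover have "rad_norm F k (\<lambda>j. T (\<lambda>i\<in>{1..n}. y i j)) = sqrt (sign_mean F {1..k} (\<lambda>j. T (\<lambda>i\<in>{1..n}. y i j)))"
    using y by (intro F.rad_norm_eq_sign_mean closed) auto
  ultimately show ?thesis
    by simp
qed

text \<open>The bound by the operator norm at each \<open>j\<close> reduces the estimate to
  \<open>generalized_Holder\<close> for the numbers \<open>vnorm (E i) (y i j)\<close>.\<close>

lemma (in multilinear_op) lp_norm_le:
  assumes "q > 0" "\<And>i. i \<in> {1..n} \<Longrightarrow> s i > 0" "1 / q \<le> (\<Sum>i=1..n. 1 / s i)"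
    and y: "\<And>i j. \<lbrakk>i \<in> {1..n}; j \<in> {1..k}\<rbrakk> \<Longrightarrow> y i j \<in> carrier (E i)"
  shows "lp_norm q F k (\<lambda>j. T (\<lambda>i\<in>{1..n}. y i j)) \<le> op_norm n E F T * (\<Prod>i=1..n. lp_norm (s i) (E i) k (y i))"
  unfolding lp_norm_def
proof -
  define K where "K = op_norm n E F T"
  have K: "K \<ge> 0"
    by (simp add: K_def op_norm_nonneg)
  have nonneg: "vnorm (E i) (y i j) \<ge> 0" if "i \<in> {1..n}" "j \<in> {1..k}" for i j
    using banach_space.vnorm_nonneg[OF banach] y that by blast
  have "vnorm F (T (\<lambda>i\<in>{1..n}. y i j)) powr q \<le> K powr q * (\<Prod>i=1..n. vnorm (E i) (y i j)) powr q"
    if j: "j \<in> {1..k}" for j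
  proof -
    have x: "(\<lambda>i\<in>{1..n}. y i j) \<in> tuples n E"
      using y j by auto
    have "vnorm F (T (\<lambda>i\<in>{1..n}. y i j)) powr q \<le> (K * (\<Prod>i=1..n. vnorm (E i) (y i j))) powr q"
      using vnorm_le_op_norm[OF x] \<open>q > 0\<close> F.vnorm_nonneg[OF closed[OF x]]
      by (intro powr_mono2) (auto simp: K_def)
    then show ?thesis
      using K nonneg j by (simp add: powr_mult prod_nonneg)
  qed
  then have "(\<Sum>j=1..k. vnorm F (T (\<lambda>i\<in>{1..n}. y i j)) powr q) powr (1 / q)
      \<le> (\<Sum>j=1..k. K powr q * (\<Prod>i=1..n. vnorm (E i) (y i j)) powr q) powr (1 / q)"
    using \<open>q > 0\<close> by (intro powr_mono2 sum_mono) (auto intro!: sum_nonneg)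
  also have "\<dots> = K * (\<Sum>j=1..k. (\<Prod>i=1..n. vnorm (E i) (y i j)) powr q) powr (1 / q)"
    using K \<open>q > 0\<close> by (simp add: powr_mult powr_powr sum_nonneg flip: sum_distrib_left)
  also have "\<dots> \<le> K * (\<Prod>i=1..n. (\<Sum>j=1..k. vnorm (E i) (y i j) powr s i) powr (1 / s i))"
    using assms(1-3) nonneg by (intro mult_left_mono K generalized_Holder) auto
  finally show "(\<Sum>j=1..k. vnorm F (T (\<lambda>i\<in>{1..n}. y i j)) powr q) powr (1 / q)
      \<le> op_norm n E F T * (\<Prod>i=1..n. (\<Sum>j=1..k. vnorm (E i) (y i j) powr s i) powr (1 / s i))"
    by (simp add: K_def)
qed

section \<open>Factorizations\<close>

lemma (in banach_space) rad_norm_cong: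
  assumes "\<And>j. j \<in> {1..k} \<Longrightarrow> y' j \<in> carrier E" "\<And>j. j \<in> {1..k} \<Longrightarrow> y j = y' j"
  shows "rad_norm E k y = rad_norm E k y'"
proof -
  have "lin_comb E {1..k} c y = lin_comb E {1..k} c y'" for c
    by (rule lin_comb_cong) (use assms in auto)
  then show ?thesis
    unfolding rad_norm_def lin_comb_def by simp
qed

lemma lp_norm_cong:
  "(\<And>j. j \<in> {1..k} \<Longrightarrow> y j = y' j) \<Longrightarrow> lp_norm p E k y = lp_norm p E k y'"
  by (simp add: lp_norm_def)

section \<open>Type and cotype constants of factorized operators\<close>

lemma lin_cotype_constD:
  assumes "cotype_const 1 q (\<lambda>_. G) F (\<lambda>x. u (x 1)) C" "\<And>j. j \<in> {1..k} \<Longrightarrow> y j \<in> carrier G"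
  shows "lp_norm q F k (\<lambda>j. u (y j)) \<le> C * rad_norm G k y"
  using assms(1)[unfolded cotype_const_def, THEN conjunct2, rule_format, of k "\<lambda>_. y"] assms(2) by simp

lemma lin_type_constD:
  assumes "type_const 1 (\<lambda>_. p) (\<lambda>_. G) F (\<lambda>x. u (x 1)) C" "\<And>j. j \<in> {1..k} \<Longrightarrow> y j \<in> carrier G"
  shows "rad_norm F k (\<lambda>j. u (y j)) \<le> C * lp_norm p G k y"
  using assms(1)[unfolded type_const_def, THEN conjunct2, rule_format, of k "\<lambda>_. y"] assms(2) by simp

lemma lin_op_closed:
  assumes "(\<lambda>x. u (x 1)) \<in> multilinear_ops 1 (\<lambda>_. G) F" "g \<in> carrier G"
  shows "u g \<in> carrier F"
proof -
  have "(\<lambda>i\<in>{1..1::nat}. g) \<in> tuples 1 (\<lambda>_. G)"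
    using assms(2) by auto
  with assms(1) have "u ((\<lambda>i\<in>{1..1::nat}. g) 1) \<in> carrier F"
    unfolding multilinear_ops_def by blast
  then show ?thesis
    by simp
qed

text \<open>The cotype of \<open>u\<close> is applied to the vectors \<open>B (x_j)\<close>, whose
  Rademacher norm is controlled by decoupling. Constants must be positive while
  \<open>op_norm\<close> may be zero, hence a \<open>K\<close> strictly above it.\<close>

lemma cotype_const_comp:
  assumes "1 \<le> n" "\<And>i. i \<in> {1..n} \<Longrightarrow> banach_space (E i)"
    and fact: "left_factorization (lin_cotype_ops q) n E F T G u B"
    and C: "cotype_const 1 q (\<lambda>_. G) F (\<lambda>x. u (x 1)) C" and K: "K > op_norm n E G B"
  shows "cotype_const n q E F T (K * C)"
  unfolding cotype_const_def
proof (intro conjI allI impI)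
  interpret B: multilinear_op G n E B
    using assms(2) fact by (simp add: left_factorization_def multilinear_op_def multilinear_op_axioms_def)
  have "C > 0"
    using C by (simp add: cotype_const_def)
  show "K * C > 0"
    using K B.op_norm_nonneg \<open>C > 0\<close> by simp
  fix k x assume x: "\<forall>i\<in>{1..n}. \<forall>j\<in>{1..k::nat}. x i j \<in> carrier (E i)"
  have tup: "(\<lambda>i\<in>{1..n}. x i j) \<in> tuples n E" if "j \<in> {1..k}" for j
    using x that by auto
  have "lp_norm q F k (\<lambda>j. T (\<lambda>i\<in>{1..n}. x i j)) = lp_norm q F k (\<lambda>j. u (B (\<lambda>i\<in>{1..n}. x i j)))"
    using fact tup unfolding left_factorization_def by (intro lp_norm_cong) blast
  also have "\<dots> \<le> C * rad_norm G k (\<lambda>j. B (\<lambda>i\<in>{1..n}. x i j))"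
    by (rule lin_cotype_constD[OF C B.closed[OF tup]])
  also have "\<dots> \<le> C * (op_norm n E G B * (\<Prod>i=1..n. rad_norm (E i) k (x i)))"
    using x \<open>1 \<le> n\<close> \<open>C > 0\<close> by (intro mult_left_mono B.rad_norm_le) auto
  also have "\<dots> \<le> C * (K * (\<Prod>i=1..n. rad_norm (E i) k (x i)))"
    using K \<open>C > 0\<close> by (intro mult_left_mono mult_right_mono prod_nonneg) (auto simp: rad_norm_def set_lebesgue_integral_def intro!: integral_nonneg)
  finally show "lp_norm q F k (\<lambda>j. T (\<lambda>i\<in>{1..n}. x i j)) \<le> K * C * (\<Prod>i=1..n. rad_norm (E i) k (x i))"
    by (simp add: mult_ac)
qed

text \<open>The type of \<open>u\<close> leads to the \<open>r\<close>-norm of the values of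
  \<open>B\<close>, which the Hoelder bound \<open>lp_norm_le\<close> distributes over the
  arguments.\<close>

lemma type_const_comp:
  assumes "banach_space F" "\<And>i. i \<in> {1..n} \<Longrightarrow> banach_space (E i)"
    and "r > 0" "\<And>i. i \<in> {1..n} \<Longrightarrow> p i > 0" "1 / r \<le> (\<Sum>i=1..n. 1 / p i)"
    and fact: "left_factorization (lin_type_ops r) n E F T G u B"
    and C: "type_const 1 (\<lambda>_. r) (\<lambda>_. G) F (\<lambda>x. u (x 1)) C" and K: "K > op_norm n E G B"
  shows "type_const n p E F T (K * C)"
  unfolding type_const_def
proof (intro conjI allI impI)
  interpret B: multilinear_op G n E B
    using assms(2) fact by (simp add: left_factorization_def multilinear_op_def multilinear_op_axioms_def)
  have "C > 0"
    using C by (simp add: type_const_def)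
  show "K * C > 0"
    using K B.op_norm_nonneg \<open>C > 0\<close> by simp
  fix k x assume x: "\<forall>i\<in>{1..n}. \<forall>j\<in>{1..k::nat}. x i j \<in> carrier (E i)"
  have tup: "(\<lambda>i\<in>{1..n}. x i j) \<in> tuples n E" if "j \<in> {1..k}" for j
    using x that by auto
  have u: "(\<lambda>x. u (x 1)) \<in> multilinear_ops 1 (\<lambda>_. G) F"
    using fact by (simp add: left_factorization_def lin_type_ops_def type_ops_def)
  have eq: "T x = u (B x)" if "x \<in> tuples n E" for x
    using fact that unfolding left_factorization_def by blast
  have "rad_norm F k (\<lambda>j. T (\<lambda>i\<in>{1..n}. x i j)) = rad_norm F k (\<lambda>j. u (B (\<lambda>i\<in>{1..n}. x i j)))"
    by (intro banach_space.rad_norm_cong[OF assms(1)] lin_op_closed[OF u] B.closed tup eq)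
  also have "\<dots> \<le> C * lp_norm r G k (\<lambda>j. B (\<lambda>i\<in>{1..n}. x i j))"
    by (rule lin_type_constD[OF C B.closed[OF tup]])
  also have "\<dots> \<le> C * (op_norm n E G B * (\<Prod>i=1..n. lp_norm (p i) (E i) k (x i)))"
    using x assms(3-5) \<open>C > 0\<close> by (intro mult_left_mono B.lp_norm_le) auto
  also have "\<dots> \<le> C * (K * (\<Prod>i=1..n. lp_norm (p i) (E i) k (x i)))"
    using K \<open>C > 0\<close> by (intro mult_left_mono mult_right_mono prod_nonneg) (auto simp: lp_norm_def)
  finally show "rad_norm F k (\<lambda>j. T (\<lambda>i\<in>{1..n}. x i j)) \<le> K * C * (\<Prod>i=1..n. lp_norm (p i) (E i) k (x i))"
    by (simp add: mult_ac)
qed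

text \<open>Here \<open>B\<close> is the outer map: Hoelder comes first and separates the slots, and
  the cotype of each \<open>u i\<close> then bounds its own factor.\<close>

lemma cotype_const_fact:
  assumes "banach_space F" and "q > 0" "\<And>i. i \<in> {1..n} \<Longrightarrow> s i > 0" "1 / q \<le> (\<Sum>i=1..n. 1 / s i)"
    and fact: "right_factorization (\<lambda>i. lin_cotype_ops (s i)) n E F T G u B"
    and C: "\<And>i. i \<in> {1..n} \<Longrightarrow> cotype_const 1 (s i) (\<lambda>_. E i) (G i) (\<lambda>x. u i (x 1)) (C i)"
    and K: "K > op_norm n G F B"
  shows "cotype_const n q E F T (K * (\<Prod>i=1..n. C i))"
  unfolding cotype_const_def
proof (intro conjI allI impI)
  interpret B: multilinear_op F n G B
    using assms(1) fact by (simp add: right_factorization_def multilinear_op_def multilinear_op_axioms_def)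
  have C_pos: "C i > 0" if "i \<in> {1..n}" for i
    using C[OF that] by (simp add: cotype_const_def)
  show "K * (\<Prod>i=1..n. C i) > 0"
    using K B.op_norm_nonneg C_pos by (intro mult_pos_pos prod_pos) auto
  fix k x assume x: "\<forall>i\<in>{1..n}. \<forall>j\<in>{1..k::nat}. x i j \<in> carrier (E i)"
  define y where "y i j = u i (x i j)" for i j
  have "(\<lambda>x. u i (x 1)) \<in> multilinear_ops 1 (\<lambda>_. E i) (G i)" if "i \<in> {1..n}" for i
    using fact that by (simp add: right_factorization_def lin_cotype_ops_def cotype_ops_def)
  then have y: "y i j \<in> carrier (G i)" if "i \<in> {1..n}" "j \<in> {1..k}" for i j
    unfolding y_def using x that by (blast intro: lin_op_closed)
  have "T (\<lambda>i\<in>{1..n}. x i j) = B (\<lambda>i\<in>{1..n}. y i j)" if "j \<in> {1..k}" for j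
  proof -
    have "(\<lambda>i\<in>{1..n}. x i j) \<in> tuples n E"
      using x that by auto
    then have "T (\<lambda>i\<in>{1..n}. x i j) = B (\<lambda>i\<in>{1..n}. u i ((\<lambda>i\<in>{1..n}. x i j) i))"
      using fact unfolding right_factorization_def by blast
    also have "(\<lambda>i\<in>{1..n}. u i ((\<lambda>i\<in>{1..n}. x i j) i)) = (\<lambda>i\<in>{1..n}. y i j)"
      by (auto simp: y_def)
    finally show ?thesis .
  qed
  then have "lp_norm q F k (\<lambda>j. T (\<lambda>i\<in>{1..n}. x i j)) = lp_norm q F k (\<lambda>j. B (\<lambda>i\<in>{1..n}. y i j))"
    by (intro lp_norm_cong)
  also have "\<dots> \<le> op_norm n G F B * (\<Prod>i=1..n. lp_norm (s i) (G i) k (y i))"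
    using assms(2-4) y by (intro B.lp_norm_le) auto
  also have "\<dots> \<le> K * (\<Prod>i=1..n. C i * rad_norm (E i) k (x i))"
  proof (intro mult_mono prod_mono conjI)
    fix i assume i: "i \<in> {1..n}"
    show "lp_norm (s i) (G i) k (y i) \<le> C i * rad_norm (E i) k (x i)"
      unfolding y_def using x i by (intro lin_cotype_constD C) auto
  qed (use K B.op_norm_nonneg in \<open>auto simp: lp_norm_def prod_nonneg\<close>)
  finally show "lp_norm q F k (\<lambda>j. T (\<lambda>i\<in>{1..n}. x i j))
      \<le> K * (\<Prod>i=1..n. C i) * (\<Prod>i=1..n. rad_norm (E i) k (x i))"
    by (simp add: prod.distrib mult.assoc)
qed

text \<open>Carries estimates between constants over to norms. The infima need not be attained, so
  each is approximated within \<epsilon> and \<epsilon> tends to 0. With a one-element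
  \<open>I\<close> this serves compositions, with \<open>{1..n}\<close> factorizations.\<close>

lemma Inf_le_mult_prod_Inf:
  fixes S :: "real set" and V :: "'i \<Rightarrow> real set"
  assumes "finite I" "a \<ge> 0" "bdd_below S"
    and V: "\<And>i. i \<in> I \<Longrightarrow> V i \<noteq> {}" "\<And>i c. \<lbrakk>i \<in> I; c \<in> V i\<rbrakk> \<Longrightarrow> c \<ge> 0"
    and S: "\<And>K c. \<lbrakk>K > a; \<And>i. i \<in> I \<Longrightarrow> c i \<in> V i\<rbrakk> \<Longrightarrow> K * (\<Prod>i\<in>I. c i) \<in> S"
  shows "Inf S \<le> a * (\<Prod>i\<in>I. Inf (V i))"
proof -
  have le: "Inf S \<le> (a + \<epsilon>) * (\<Prod>i\<in>I. Inf (V i) + \<epsilon>)" if "\<epsilon> > 0" for \<epsilon>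
  proof -
    have "\<exists>c. c \<in> V i \<and> c < Inf (V i) + \<epsilon>" if "i \<in> I" for i
      using cInf_lessD[OF V(1)[OF that], of "Inf (V i) + \<epsilon>"] \<open>\<epsilon> > 0\<close> by auto
    then obtain c where c: "\<And>i. i \<in> I \<Longrightarrow> c i \<in> V i" "\<And>i. i \<in> I \<Longrightarrow> c i < Inf (V i) + \<epsilon>"
      by metis
    have "Inf S \<le> (a + \<epsilon>) * (\<Prod>i\<in>I. c i)"
      using that c by (intro cInf_lower assms(3) S) auto
    also have "\<dots> \<le> (a + \<epsilon>) * (\<Prod>i\<in>I. Inf (V i) + \<epsilon>)"
      using that c V(2) \<open>a \<ge> 0\<close> by (intro mult_left_mono prod_mono conjI) (auto intro: less_imp_le)
    finally show ?thesis .
  qed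
  \<comment> \<open>The limit is one-sided because \<open>le\<close> holds for positive \<epsilon>
    only.\<close>
  have "((\<lambda>\<epsilon>. (a + \<epsilon>) * (\<Prod>i\<in>I. Inf (V i) + \<epsilon>)) \<longlongrightarrow> (a + 0) * (\<Prod>i\<in>I. Inf (V i) + 0)) (at_right 0)"
    by (intro tendsto_intros)
  then have "Inf S \<le> (a + 0) * (\<Prod>i\<in>I. Inf (V i) + 0)"
    by (rule tendsto_lowerbound) (auto simp: eventually_at_right_less le intro: eventually_mono[OF eventually_at_right_less])
  then show ?thesis
    by simp
qed

lemma type_const_pos: "type_const n p E F T C \<Longrightarrow> C > 0"
  by (simp add: type_const_def)

lemma cotype_const_pos: "cotype_const n q E F T C \<Longrightarrow> C > 0"
  by (simp add: cotype_const_def)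

lemma bdd_below_type_const: "bdd_below {C. type_const n p E F T C}"
  by (auto simp: bdd_below_def intro!: exI[of _ 0] intro: less_imp_le type_const_pos)

lemma bdd_below_cotype_const: "bdd_below {C. cotype_const n q E F T C}"
  by (auto simp: bdd_below_def intro!: exI[of _ 0] intro: less_imp_le cotype_const_pos)

section \<open>The three inclusions with their norm inequalities\<close>

lemma comp_ops_imp_cotype_ops:
  fixes E :: "nat \<Rightarrow> ('k::real_normed_field, 'e) normed_module" and F :: "('k, 'f) normed_module"
  assumes "1 \<le> n" "\<And>i. i \<in> {1..n} \<Longrightarrow> banach_space (E i)"
    and T: "T \<in> comp_ops TYPE('g) (lin_cotype_ops q) n E F"
  shows "T \<in> cotype_ops n q E F"
proof -
  obtain G :: "('k, 'g) normed_module" and u B where fact: "left_factorization (lin_cotype_ops q) n E F T G u B"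
    using T by (auto simp: comp_ops_def)
  then obtain C where C: "cotype_const 1 q (\<lambda>_. G) F (\<lambda>x. u (x 1)) C"
    by (auto simp: left_factorization_def lin_cotype_ops_def cotype_ops_def)
  show ?thesis
    \<comment> \<open>Membership asks for some constant only, so any number above the operator norm
      will do.\<close>
    using cotype_const_comp[OF assms(1,2) fact C, of "op_norm n E G B + 1"] T
    by (auto simp: cotype_ops_def comp_ops_def)
qed

text \<open>Every single factorization gives an upper bound for the cotype norm, so the infimum over
  all of them does too. The set is nonempty because \<open>T\<close> belongs to the class.\<close>

lemma cotype_norm_le_comp_norm:
  fixes E :: "nat \<Rightarrow> ('k::real_normed_field, 'e) normed_module" and F :: "('k, 'f) normed_module"
  assumes "1 \<le> n" "\<And>i. i \<in> {1..n} \<Longrightarrow> banach_space (E i)"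
    and T: "T \<in> comp_ops TYPE('g) (lin_cotype_ops q) n E F"
  shows "cotype_norm n q E F T \<le> comp_norm TYPE('g) (lin_cotype_ops q) (lin_cotype_norm q) n E F T"
  unfolding comp_norm_def
proof (rule cInf_greatest)
  obtain G :: "('k, 'g) normed_module" and u B where fact: "left_factorization (lin_cotype_ops q) n E F T G u B"
    using T by (auto simp: comp_ops_def)
  show "{op_norm n E G B * lin_cotype_norm q G F u | G (u :: 'g \<Rightarrow> 'f) B.
      left_factorization (lin_cotype_ops q) n E F T G u B} \<noteq> {}"
    using fact by blast
  fix a assume "a \<in> {op_norm n E G B * lin_cotype_norm q G F u | G (u :: 'g \<Rightarrow> 'f) B.
      left_factorization (lin_cotype_ops q) n E F T G u B}"
  then obtain G :: "('k, 'g) normed_module" and u B where a: "a = op_norm n E G B * lin_cotype_norm q G F u"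
    and fact: "left_factorization (lin_cotype_ops q) n E F T G u B"
    by blast
  interpret B: multilinear_op G n E B
    using assms(2) fact by (simp add: left_factorization_def multilinear_op_def multilinear_op_axioms_def)
  \<comment> \<open>The product over \<open>{()}\<close> has a single factor and brings the linear
    norm into the form of \<open>Inf_le_mult_prod_Inf\<close>.\<close>
  have "cotype_norm n q E F T \<le> op_norm n E G B
      * (\<Prod>i\<in>{()}. Inf {C. cotype_const 1 q (\<lambda>_. G) F (\<lambda>x. u (x 1)) C})"
    unfolding cotype_norm_def
  proof (rule Inf_le_mult_prod_Inf)
    show "{C. cotype_const 1 q (\<lambda>_. G) F (\<lambda>x. u (x 1)) C} \<noteq> {}"
      using fact by (auto simp: left_factorization_def lin_cotype_ops_def cotype_ops_def)
    show "K * (\<Prod>i\<in>{()}. c i) \<in> {C. cotype_const n q E F T C}"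
      if "K > op_norm n E G B" "\<And>i. i \<in> {()} \<Longrightarrow> c i \<in> {C. cotype_const 1 q (\<lambda>_. G) F (\<lambda>x. u (x 1)) C}" for K c
      using that cotype_const_comp[OF assms(1,2) fact] by simp
  qed (use B.op_norm_nonneg bdd_below_cotype_const in \<open>auto intro: less_imp_le cotype_const_pos\<close>)
  then show "cotype_norm n q E F T \<le> a"
    by (simp add: a lin_cotype_norm_def cotype_norm_def)
qed

lemma comp_ops_imp_type_ops:
  fixes E :: "nat \<Rightarrow> ('k::real_normed_field, 'e) normed_module" and F :: "('k, 'f) normed_module"
  assumes "banach_space F" "\<And>i. i \<in> {1..n} \<Longrightarrow> banach_space (E i)"
    and "r > 0" "\<And>i. i \<in> {1..n} \<Longrightarrow> p i > 0" "1 / r \<le> (\<Sum>i=1..n. 1 / p i)"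
    and T: "T \<in> comp_ops TYPE('g) (lin_type_ops r) n E F"
  shows "T \<in> type_ops n p E F"
proof -
  have const: "type_const n p E F T (K * C)"
    if "left_factorization (lin_type_ops r) n E F T G u B"
      "type_const 1 (\<lambda>_. r) (\<lambda>_. G) F (\<lambda>x. u (x 1)) C" "K > op_norm n E G B"
    for G :: "('k, 'g) normed_module" and u B K C
    using that assms(1-5) by (intro type_const_comp) auto
  obtain G :: "('k, 'g) normed_module" and u B where fact: "left_factorization (lin_type_ops r) n E F T G u B"
    using T by (auto simp: comp_ops_def)
  then obtain C where C: "type_const 1 (\<lambda>_. r) (\<lambda>_. G) F (\<lambda>x. u (x 1)) C"
    by (auto simp: left_factorization_def lin_type_ops_def type_ops_def)
  show ?thesis
    using const[OF fact C, of "op_norm n E G B + 1"] T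
    by (auto simp: type_ops_def comp_ops_def)
qed

lemma type_norm_le_comp_norm:
  fixes E :: "nat \<Rightarrow> ('k::real_normed_field, 'e) normed_module" and F :: "('k, 'f) normed_module"
  assumes "banach_space F" "\<And>i. i \<in> {1..n} \<Longrightarrow> banach_space (E i)"
    and "r > 0" "\<And>i. i \<in> {1..n} \<Longrightarrow> p i > 0" "1 / r \<le> (\<Sum>i=1..n. 1 / p i)"
    and T: "T \<in> comp_ops TYPE('g) (lin_type_ops r) n E F"
  shows "type_norm n p E F T \<le> comp_norm TYPE('g) (lin_type_ops r) (lin_type_norm r) n E F T"
  unfolding comp_norm_def
proof (rule cInf_greatest)
  have const: "type_const n p E F T (K * C)"
    if "left_factorization (lin_type_ops r) n E F T G u B"
      "type_const 1 (\<lambda>_. r) (\<lambda>_. G) F (\<lambda>x. u (x 1)) C" "K > op_norm n E G B"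
    for G :: "('k, 'g) normed_module" and u B K C
    using that assms(1-5) by (intro type_const_comp) auto
  obtain G :: "('k, 'g) normed_module" and u B where fact: "left_factorization (lin_type_ops r) n E F T G u B"
    using T by (auto simp: comp_ops_def)
  show "{op_norm n E G B * lin_type_norm r G F u | G (u :: 'g \<Rightarrow> 'f) B.
      left_factorization (lin_type_ops r) n E F T G u B} \<noteq> {}"
    using fact by blast
  fix a assume "a \<in> {op_norm n E G B * lin_type_norm r G F u | G (u :: 'g \<Rightarrow> 'f) B.
      left_factorization (lin_type_ops r) n E F T G u B}"
  then obtain G :: "('k, 'g) normed_module" and u B where a: "a = op_norm n E G B * lin_type_norm r G F u"
    and fact: "left_factorization (lin_type_ops r) n E F T G u B"
    by blast
  interpret B: multilinear_op G n E B
    using assms(2) fact by (simp add: left_factorization_def multilinear_op_def multilinear_op_axioms_def)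
  have "type_norm n p E F T \<le> op_norm n E G B
      * (\<Prod>i\<in>{()}. Inf {C. type_const 1 (\<lambda>_. r) (\<lambda>_. G) F (\<lambda>x. u (x 1)) C})"
    unfolding type_norm_def
  proof (rule Inf_le_mult_prod_Inf)
    show "{C. type_const 1 (\<lambda>_. r) (\<lambda>_. G) F (\<lambda>x. u (x 1)) C} \<noteq> {}"
      using fact by (auto simp: left_factorization_def lin_type_ops_def type_ops_def)
    show "K * (\<Prod>i\<in>{()}. c i) \<in> {C. type_const n p E F T C}"
      if "K > op_norm n E G B" "\<And>i. i \<in> {()} \<Longrightarrow> c i \<in> {C. type_const 1 (\<lambda>_. r) (\<lambda>_. G) F (\<lambda>x. u (x 1)) C}" for K c
      using that const[OF fact] by simp
  qed (use B.op_norm_nonneg bdd_below_type_const in \<open>auto intro: less_imp_le type_const_pos\<close>)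
  then show "type_norm n p E F T \<le> a"
    by (simp add: a lin_type_norm_def type_norm_def)
qed

lemma fact_ops_imp_cotype_ops:
  fixes E :: "nat \<Rightarrow> ('k::real_normed_field, 'e) normed_module" and F :: "('k, 'f) normed_module"
  assumes "banach_space F" and "q > 0" "\<And>i. i \<in> {1..n} \<Longrightarrow> s i > 0" "1 / q \<le> (\<Sum>i=1..n. 1 / s i)"
    and T: "T \<in> fact_ops TYPE('g) (\<lambda>i. lin_cotype_ops (s i)) n E F"
  shows "T \<in> cotype_ops n q E F"
proof -
  note const = cotype_const_fact[OF assms(1,2)]
  have ex: "\<exists>C. cotype_const 1 (s i) (\<lambda>_. E i) (G i) (\<lambda>x. u i (x 1)) C"
    if "right_factorization (\<lambda>i. lin_cotype_ops (s i)) n E F T G u B" "i \<in> {1..n}"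
    for G :: "nat \<Rightarrow> ('k, 'g) normed_module" and u B i
    using that by (auto simp: right_factorization_def lin_cotype_ops_def cotype_ops_def)
  obtain G :: "nat \<Rightarrow> ('k, 'g) normed_module" and u B
    where fact: "right_factorization (\<lambda>i. lin_cotype_ops (s i)) n E F T G u B"
    using T by (auto simp: fact_ops_def)
  \<comment> \<open>One constant is chosen for each of the \<open>n\<close> linear factors.\<close>
  then obtain C where C: "\<And>i. i \<in> {1..n} \<Longrightarrow> cotype_const 1 (s i) (\<lambda>_. E i) (G i) (\<lambda>x. u i (x 1)) (C i)"
    using ex by metis
  have "cotype_const n q E F T ((op_norm n G F B + 1) * (\<Prod>i=1..n. C i))"
    by (rule const[OF assms(3,4) fact C]) auto
  then show ?thesis
    using T by (auto simp: cotype_ops_def fact_ops_def)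
qed

lemma cotype_norm_le_fact_norm:
  fixes E :: "nat \<Rightarrow> ('k::real_normed_field, 'e) normed_module" and F :: "('k, 'f) normed_module"
  assumes "banach_space F" and "q > 0" "\<And>i. i \<in> {1..n} \<Longrightarrow> s i > 0" "1 / q \<le> (\<Sum>i=1..n. 1 / s i)"
    and T: "T \<in> fact_ops TYPE('g) (\<lambda>i. lin_cotype_ops (s i)) n E F"
  shows "cotype_norm n q E F T
      \<le> fact_norm TYPE('g) (\<lambda>i. lin_cotype_ops (s i)) (\<lambda>i. lin_cotype_norm (s i)) n E F T"
  unfolding fact_norm_def
proof (rule cInf_greatest)
  note const = cotype_const_fact[OF assms(1,2)]
  have ex: "\<exists>C. cotype_const 1 (s i) (\<lambda>_. E i) (G i) (\<lambda>x. u i (x 1)) C"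
    if "right_factorization (\<lambda>i. lin_cotype_ops (s i)) n E F T G u B" "i \<in> {1..n}"
    for G :: "nat \<Rightarrow> ('k, 'g) normed_module" and u B i
    using that by (auto simp: right_factorization_def lin_cotype_ops_def cotype_ops_def)
  obtain G :: "nat \<Rightarrow> ('k, 'g) normed_module" and u B
    where fact: "right_factorization (\<lambda>i. lin_cotype_ops (s i)) n E F T G u B"
    using T by (auto simp: fact_ops_def)
  show "{op_norm n G F B * (\<Prod>i=1..n. lin_cotype_norm (s i) (E i) (G i) (u i)) | G (u :: nat \<Rightarrow> 'e \<Rightarrow> 'g) B.
      right_factorization (\<lambda>i. lin_cotype_ops (s i)) n E F T G u B} \<noteq> {}"
    using fact by blast
  fix a assume "a \<in> {op_norm n G F B * (\<Prod>i=1..n. lin_cotype_norm (s i) (E i) (G i) (u i)) | G (u :: nat \<Rightarrow> 'e \<Rightarrow> 'g) B.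
      right_factorization (\<lambda>i. lin_cotype_ops (s i)) n E F T G u B}"
  then obtain G :: "nat \<Rightarrow> ('k, 'g) normed_module" and u B
    where a: "a = op_norm n G F B * (\<Prod>i=1..n. lin_cotype_norm (s i) (E i) (G i) (u i))"
      and fact: "right_factorization (\<lambda>i. lin_cotype_ops (s i)) n E F T G u B"
    by blast
  interpret B: multilinear_op F n G B
    using assms(1) fact by (simp add: right_factorization_def multilinear_op_def multilinear_op_axioms_def)
  have "cotype_norm n q E F T \<le> op_norm n G F B
      * (\<Prod>i=1..n. Inf {C. cotype_const 1 (s i) (\<lambda>_. E i) (G i) (\<lambda>x. u i (x 1)) C})"
    unfolding cotype_norm_def
  proof (rule Inf_le_mult_prod_Inf)
    show "K * (\<Prod>i=1..n. c i) \<in> {C. cotype_const n q E F T C}"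
      if "K > op_norm n G F B"
        "\<And>i. i \<in> {1..n} \<Longrightarrow> c i \<in> {C. cotype_const 1 (s i) (\<lambda>_. E i) (G i) (\<lambda>x. u i (x 1)) C}" for K c
      using that by (auto intro!: const[OF assms(3,4) fact])
  qed (use B.op_norm_nonneg bdd_below_cotype_const ex[OF fact] in \<open>auto intro: less_imp_le cotype_const_pos\<close>)
  then show "cotype_norm n q E F T \<le> a"
    by (simp add: a lin_cotype_norm_def cotype_norm_def)
qed

theorem theorem3p1:
  fixes n :: nat and p :: "nat \<Rightarrow> real" and q :: real
    and E :: "nat \<Rightarrow> ('k::real_normed_field, 'e) normed_module"
    and F :: "('k, 'f) normed_module"
  assumes "n \<ge> 2"
    and "\<And>i. i \<in> {1..n} \<Longrightarrow> p i > 0"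
    and "1 / 2 \<le> (\<Sum>i=1..n. 1 / p i)" and "(\<Sum>i=1..n. 1 / p i) < 1"
    and "2 / real n \<le> q"
    and "\<And>i. i \<in> {1..n} \<Longrightarrow> banach_space (E i)"
    and "banach_space F"
  shows
    "(q \<ge> 2 \<longrightarrow>
        comp_ops TYPE('g) (lin_cotype_ops q) n E F \<subseteq> cotype_ops n q E F \<and>
        (\<forall>T \<in> comp_ops TYPE('g) (lin_cotype_ops q) n E F.
           cotype_norm n q E F T
             \<le> comp_norm TYPE('g) (lin_cotype_ops q) (lin_cotype_norm q) n E F T)) \<and>
     (\<forall>r::real. 0 < r \<and> 1 / r \<le> (\<Sum>i=1..n. 1 / p i) \<longrightarrow>
        comp_ops TYPE('g) (lin_type_ops r) n E F \<subseteq> type_ops n p E F \<and>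
        (\<forall>T \<in> comp_ops TYPE('g) (lin_type_ops r) n E F.
           type_norm n p E F T
             \<le> comp_norm TYPE('g) (lin_type_ops r) (lin_type_norm r) n E F T)) \<and>
     (\<forall>s::nat \<Rightarrow> real. (\<forall>i\<in>{1..n}. 0 < s i) \<and> 1 / q \<le> (\<Sum>i=1..n. 1 / s i) \<longrightarrow>
        fact_ops TYPE('g) (\<lambda>i. lin_cotype_ops (s i)) n E F \<subseteq> cotype_ops n q E F \<and>
        (\<forall>T \<in> fact_ops TYPE('g) (\<lambda>i. lin_cotype_ops (s i)) n E F.
           cotype_norm n q E F T
             \<le> fact_norm TYPE('g) (\<lambda>i. lin_cotype_ops (s i)) (\<lambda>i. lin_cotype_norm (s i)) n E F T))"
proof -
  \<comment> \<open>Positivity of \<open>q\<close> comes from its lower bound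
    \<open>2 / real n\<close>.\<close>
  have "1 \<le> n" "q > 0"
    using \<open>n \<ge> 2\<close> \<open>2 / real n \<le> q\<close> less_le_trans[of 0 "2 / real n" q] by auto
  show ?thesis
  proof (intro conjI allI impI ballI subsetI; (elim conjE)?)
    fix T
    assume T: "T \<in> comp_ops TYPE('g) (lin_cotype_ops q) n E F"
    show "T \<in> cotype_ops n q E F"
      "cotype_norm n q E F T \<le> comp_norm TYPE('g) (lin_cotype_ops q) (lin_cotype_norm q) n E F T"
      using comp_ops_imp_cotype_ops[OF \<open>1 \<le> n\<close> assms(6) T]
        cotype_norm_le_comp_norm[OF \<open>1 \<le> n\<close> assms(6) T] by auto
  next
    fix r :: real and T
    assume r: "0 < r" "1 / r \<le> (\<Sum>i=1..n. 1 / p i)"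
      and T: "T \<in> comp_ops TYPE('g) (lin_type_ops r) n E F"
    show "T \<in> type_ops n p E F"
      "type_norm n p E F T \<le> comp_norm TYPE('g) (lin_type_ops r) (lin_type_norm r) n E F T"
      using comp_ops_imp_type_ops[OF assms(7,6) r(1) assms(2) r(2) T]
        type_norm_le_comp_norm[OF assms(7,6) r(1) assms(2) r(2) T] by auto
  next
    fix s :: "nat \<Rightarrow> real" and T
    assume s: "\<forall>i\<in>{1..n}. 0 < s i" "1 / q \<le> (\<Sum>i=1..n. 1 / s i)"
      and T: "T \<in> fact_ops TYPE('g) (\<lambda>i. lin_cotype_ops (s i)) n E F"
    show "T \<in> cotype_ops n q E F"
      "cotype_norm n q E F T
        \<le> fact_norm TYPE('g) (\<lambda>i. lin_cotype_ops (s i)) (\<lambda>i. lin_cotype_norm (s i)) n E F T"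
      using fact_ops_imp_cotype_ops[OF assms(7) \<open>q > 0\<close> bspec[OF s(1)] s(2) T]
        cotype_norm_le_fact_norm[OF assms(7) \<open>q > 0\<close> bspec[OF s(1)] s(2) T] by auto
  qed
qed

end
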